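(* Let $Y_1,\dots,Y_q$ be locally Lipschitz vector fields on $\mathbb{R}^n$, $Y_j=g_j\cdot\nabla$, satisfying condition (H): for every bounded open $\Omega\subset\mathbb{R}^n$ there is $C_\Omega>0$ with $[Y_j,Y_k]_x:=(Y_jg_k(x)-Y_kg_j(x))\cdot\nabla\in P_x^{C_\Omega}$ for a.e. $x\in\Omega$ and all $j,k$. Then for every $x_0\in\mathbb{R}^n$ we have $p_x=p_{x_0}$ for all $x\in\mathcal{O}^{x_0}$.
   Context: $Y_j=\sum_\alpha g_j^\alpha\partial_\alpha$ with $g_j:\mathbb{R}^n\to\mathbb{R}^n$ locally Lipschitz; $Y_jg_k(x):=Dg_k(x)g_j(x)$, defined a.e. by Rademacher. $P_x:=\mathrm{Span}\{Y_1(x),\dots,Y_q(x)\}$, $p_x:=\dim P_x$, $P_x^r:=\{\sum_j c_jY_j(x):|c|\le r\}$. A subunit path is a Lipschitz $\gamma:[0,T]\to\mathbb{R}^n$ with $\dot\gamma=\sum_j u_j(t)Y_j(\gamma)$ a.e., $u$ measurable, $|u(t)|\le1$ a.e. $d(x,y)$ is the infimum of $T\ge0$ such that a subunit path on $[0,T]$ joins $x$ to $y$ ($=\infty$ if none exists), and $\mathcal{O}^{x_0}:=\{y:d(x_0,y)<\infty\}$. *)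

theory Defs
  imports "HOL-Analysis.Analysis"
begin

text \<open>Vector fields Y_j = g j, for j < q, on R^n = real^'n.\<close>

definition loc_lipschitz :: "('a::metric_space \<Rightarrow> 'b::metric_space) \<Rightarrow> bool" where
  "loc_lipschitz f \<longleftrightarrow> (\<forall>x. \<exists>r>0. \<exists>L. L-lipschitz_on (ball x r) f)"

definition Pr :: "nat \<Rightarrow> (nat \<Rightarrow> real^'n \<Rightarrow> real^'n) \<Rightarrow> real^'n \<Rightarrow> real \<Rightarrow> (real^'n) set" where
  "Pr q g x r = {(\<Sum>j<q. c j *\<^sub>R g j x) | c. sqrt (\<Sum>j<q. (c j)\<^sup>2) \<le> r}"

definition Px :: "nat \<Rightarrow> (nat \<Rightarrow> real^'n \<Rightarrow> real^'n) \<Rightarrow> real^'n \<Rightarrow> (real^'n) set" where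
  "Px q g x = span {g j x | j. j < q}"

definition px :: "nat \<Rightarrow> (nat \<Rightarrow> real^'n \<Rightarrow> real^'n) \<Rightarrow> real^'n \<Rightarrow> nat" where
  "px q g x = dim (Px q g x)"

text \<open>Y_j g_k(x) = Dg_k(x) g_j(x); bracket [Y_j,Y_k]_x (coefficient vector).\<close>
definition bracket :: "(nat \<Rightarrow> real^'n \<Rightarrow> real^'n) \<Rightarrow> nat \<Rightarrow> nat \<Rightarrow> real^'n \<Rightarrow> real^'n" where
  "bracket g j k x = frechet_derivative (g k) (at x) (g j x) - frechet_derivative (g j) (at x) (g k x)"

definition subunit_path :: "nat \<Rightarrow> (nat \<Rightarrow> real^'n \<Rightarrow> real^'n) \<Rightarrow> real \<Rightarrow> (real \<Rightarrow> real^'n) \<Rightarrow> bool" where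
  "subunit_path q g T \<gamma> \<longleftrightarrow> T \<ge> 0 \<and> (\<exists>L. L-lipschitz_on {0..T} \<gamma>) \<and>
     (\<exists>u :: real \<Rightarrow> nat \<Rightarrow> real.
        (\<forall>j<q. (\<lambda>t. u t j) \<in> borel_measurable (lebesgue_on {0..T})) \<and>
        (AE t in lebesgue_on {0..T}. sqrt (\<Sum>j<q. (u t j)\<^sup>2) \<le> 1) \<and>
        (AE t in lebesgue_on {0..T}.
           (\<gamma> has_vector_derivative (\<Sum>j<q. u t j *\<^sub>R g j (\<gamma> t))) (at t)))"

definition subunit_dist :: "nat \<Rightarrow> (nat \<Rightarrow> real^'n \<Rightarrow> real^'n) \<Rightarrow> real^'n \<Rightarrow> real^'n \<Rightarrow> ennreal" where
  "subunit_dist q g x y =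
     (INF T \<in> {T. \<exists>\<gamma>. subunit_path q g T \<gamma> \<and> \<gamma> 0 = x \<and> \<gamma> T = y}. ennreal T)"

definition orbit :: "nat \<Rightarrow> (nat \<Rightarrow> real^'n \<Rightarrow> real^'n) \<Rightarrow> real^'n \<Rightarrow> (real^'n) set" where
  "orbit q g x0 = {y. subunit_dist q g x0 y < \<infinity>}"

end

theory Submission
  imports Defs
begin

text \<open>
  For \<open>p \<ge> 1\<close> let \<open>h(x)\<close> be the distance of the tuple \<open>(g\<^sub>0 x, \<dots>, g\<^sub>q\<^sub>-\<^sub>1 x)\<close> from the set of tuples
  spanning a space of dimension less than \<open>p\<close>; as this set is closed, \<open>h(x) = 0\<close> holds iff \<open>p\<^sub>x < p\<close>.
  At a point where all fields are differentiable (almost every point, by Rademacher's theorem),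
  condition (H) says that moving in a direction \<open>\<Sum>\<^sub>j u\<^sub>j g\<^sub>j\<close> changes the matrix \<open>A\<close> of the fields by
  \<open>BA + AC\<close> with bounded \<open>B\<close>, \<open>C\<close>. Since \<open>A \<mapsto> (1 + sB)A(1 + sC)\<close> does not increase the rank, \<open>h\<close> grows
  in that direction at rate at most \<open>K h\<close>. For the Lipschitz function \<open>h\<close>, averaging over small balls
  upgrades this estimate from almost every point to every point, in particular to the points of a
  path, and Gronwall's inequality shows that \<open>h\<close> stays zero along a subunit path once it vanishes
  at its start. Reversing the path gives the converse.
\<close>

section \<open>Differentiability of Lipschitz functions of one variable\<close>

text \<open>For \<open>n \<ge> 2\<close> the image of a path is a null set, so nothing known almost
  everywhere can be used along it directly. The estimate has to be carried to every point first,
  which calls for a quantity that is Lipschitz in the point: the rank is not, the distance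
  \<open>h\<close> is. Distance also replaces any expansion of minors by one remark: a map that does
  not raise the rank sends tuples of small rank to tuples of small rank. Since \<open>h\<close> has
  no derivative in general, growth is always expressed by one-sided bounds,
  \<open>h (x + d v) - h x \<le> (K h x + e) d\<close> for all small \<open>d > 0\<close>, for every
  \<open>e > 0\<close>. Bounded bracket coefficients, rather than mere membership of the bracket in
  the span, provide a single \<open>K\<close> up to the points where the rank drops. The controls of
  a path are only measurable in time; at each time they are frozen, and the estimate is applied to
  constant coefficients.\<close>

lemma lmeasurable_outer_open:
  assumes "S \<in> lmeasurable" "0 < e"
  obtains T where "open T" "S \<subseteq> T" "T \<in> lmeasurable" "measure lebesgue T < measure lebesgue S + e"
proof -
  obtain T where T: "open T" "S \<subseteq> T" "T - S \<in> lmeasurable" "emeasure lebesgue (T - S) < ennreal e"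
    using sets_lebesgue_outer_open[OF fmeasurableD[OF assms(1)] assms(2)] by blast
  have TS: "T = S \<union> (T - S)" using T(2) by blast
  have "T \<in> lmeasurable"
    by (subst TS) (rule fmeasurable.Un[OF assms(1) T(3)])
  moreover have "measure lebesgue T \<le> measure lebesgue S + measure lebesgue (T - S)"
    by (subst TS) (intro measure_Un_le fmeasurableD assms(1) T(3))
  moreover have "measure lebesgue (T - S) < e"
    using T(3,4) \<open>0 < e\<close> by (simp add: emeasure_eq_measure2 ennreal_less_iff)
  ultimately show thesis using that T by force
qed

text \<open>Vitali's theorem picks disjoint short intervals inside \<open>G\<close> that cover
  \<open>S\<close> up to a null set. Each has an image at most \<open>p\<close> times as long, and
  disjointness bounds the total length by that of \<open>G\<close>. The uncovered part is null, and
  so is its image under the Lipschitz map \<open>F\<close>. The conclusion speaks of a measurable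
  superset because \<open>S\<close> is an arbitrary set.\<close>

lemma image_subset_measure_le_slope:
  fixes F :: "real \<Rightarrow> real"
  assumes lip: "L-lipschitz_on UNIV F" and mono: "mono F" and "0 \<le> p"
    and G: "open G" "G \<in> lmeasurable" "S \<subseteq> G"
    and slope: "\<And>x e. x \<in> S \<Longrightarrow> 0 < e \<Longrightarrow> \<exists>a b. a < x \<and> x < b \<and> b - a < e \<and> F b - F a \<le> p * (b - a)"
  shows "\<exists>T \<in> lmeasurable. F ` S \<subseteq> T \<and> measure lebesgue T \<le> p * measure lebesgue G"
proof -
  define K where "K = {(c, r). 0 < r \<and> ball c r \<subseteq> G \<and> F (c + r) - F (c - r) \<le> p * ((c + r) - (c - r))}"
  obtain C where C: "countable C" "C \<subseteq> K"
    and disj: "pairwise (\<lambda>i j. disjnt (ball (fst i) (snd i)) (ball (fst j) (snd j))) C"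
    and neg: "negligible (S - (\<Union>i \<in> C. ball (fst i) (snd i)))"
  proof (rule Vitali_covering_theorem_balls[of S K fst snd])
    fix x d :: real assume x: "x \<in> S" and "0 < d"
    obtain k where k: "k > 0" "ball x k \<subseteq> G"
      using G x by (meson openE subsetD)
    obtain a b where ab: "a < x" "x < b" "b - a < min k d" "F b - F a \<le> p * (b - a)"
      using slope[of x "min k d"] x k \<open>0 < d\<close> by auto
    have "ball ((a + b)/2) ((b - a)/2) \<subseteq> ball x k"
      using ab by (auto simp: dist_real_def abs_if field_simps split: if_splits)
    then have sub: "ball ((a + b)/2) ((b - a)/2) \<subseteq> G" using k(2) by (rule order_trans)
    have *: "(a + b)/2 + (b - a)/2 = b" "(a + b)/2 - (b - a)/2 = a"
      by (simp_all add: field_simps)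
    have "((a + b)/2, (b - a)/2) \<in> K"
      unfolding K_def mem_Collect_eq case_prod_conv * using ab sub by simp
    moreover have "x \<in> ball ((a + b)/2) ((b - a)/2)"
      using ab by (auto simp: dist_real_def abs_if field_simps)
    ultimately show "\<exists>i. i \<in> K \<and> x \<in> ball (fst i) (snd i) \<and> snd i < d"
      using ab by (intro exI[of _ "((a + b)/2, (b - a)/2)"]) auto
  qed
  let ?I = "\<lambda>i. {F (fst i - snd i) .. F (fst i + snd i)}"
  let ?U = "\<Union>i\<in>C. ?I i"
  have Ui: "measure lebesgue (\<Union>i\<in>J. ?I i) \<le> p * measure lebesgue G" if J: "J \<subseteq> C" "finite J" for J
  proof -
    have pos: "0 < snd i" if "i \<in> J" for i
      using that J C by (auto simp: K_def)
    have "measure lebesgue (\<Union>i\<in>J. ?I i) \<le> (\<Sum>i\<in>J. measure lebesgue (?I i))"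
      by (intro measure_UNION_le that) auto
    also have "\<dots> \<le> (\<Sum>i\<in>J. p * measure lebesgue (ball (fst i) (snd i)))"
    proof (rule sum_mono)
      fix i assume i: "i \<in> J"
      have "F (fst i - snd i) \<le> F (fst i + snd i)"
        by (rule monoD[OF mono]) (use pos[OF i] in simp)
      moreover have "F (fst i + snd i) - F (fst i - snd i) \<le> p * (2 * snd i)"
        using i J C by (auto simp: K_def)
      moreover have "measure lebesgue (ball (fst i) (snd i)) = 2 * snd i"
        using pos[OF i] by (simp add: ball_eq_greaterThanLessThan)
      ultimately show "measure lebesgue (?I i) \<le> p * measure lebesgue (ball (fst i) (snd i))"
        by simp
    qed
    also have "\<dots> = p * measure lebesgue (\<Union>i\<in>J. ball (fst i) (snd i))"
    proof -
      have "measure lebesgue (\<Union>i\<in>J. ball (fst i) (snd i)) = (\<Sum>i\<in>J. measure lebesgue (ball (fst i) (snd i)))"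
        using disj J
        by (intro measure_UNION'[OF _ _ pairwise_subset[OF disj]]) auto
      then show ?thesis by (simp add: sum_distrib_left)
    qed
    also have "\<dots> \<le> p * measure lebesgue G"
    proof (rule mult_left_mono[OF measure_mono_fmeasurable])
      show "(\<Union>i\<in>J. ball (fst i) (snd i)) \<subseteq> G"
        using C J by (fastforce simp: K_def)
      show "(\<Union>i\<in>J. ball (fst i) (snd i)) \<in> sets lebesgue"
        using J by (intro sets.finite_UN) auto
    qed (use G \<open>0 \<le> p\<close> in auto)
    finally show ?thesis .
  qed
  have U: "?U \<in> lmeasurable" "measure lebesgue ?U \<le> p * measure lebesgue G"
    by (rule fmeasurable_UN_bound[OF C(1) _ Ui] measure_UN_bound[OF C(1) _ Ui]; auto)+
  define N where "N = S - (\<Union>i \<in> C. ball (fst i) (snd i))"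
  have negF: "negligible (F ` N)"
  proof (rule negligible_locally_Lipschitz_image)
    show "negligible N" using neg by (simp add: N_def)
    show "\<exists>T B. open T \<and> x \<in> T \<and> (\<forall>y \<in> N \<inter> T. norm (F y - F x) \<le> B * norm (y - x))" for x
      using lipschitz_onD[OF lip] by (intro exI[of _ UNIV] exI[of _ L]) (auto simp: dist_norm)
  qed simp
  have "F ` S \<subseteq> ?U \<union> F ` N"
  proof (rule image_subsetI)
    fix x assume "x \<in> S"
    show "F x \<in> ?U \<union> F ` N"
    proof (cases "x \<in> N")
      case False
      then obtain i where i: "i \<in> C" "x \<in> ball (fst i) (snd i)"
        using \<open>x \<in> S\<close> by (auto simp: N_def)
      then have "fst i - snd i \<le> x" "x \<le> fst i + snd i"
        by (auto simp: dist_real_def abs_if split: if_splits)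
      then show ?thesis using monoD[OF mono] i(1) by auto
    qed auto
  qed
  moreover have "?U \<union> F ` N \<in> lmeasurable"
    using U(1) negligible_imp_measurable[OF negF] by (rule fmeasurable.Un)
  moreover have "measure lebesgue (?U \<union> F ` N) = measure lebesgue ?U"
    using negF by (intro measure_Un_null_set fmeasurableD U(1)) (simp add: negligible_iff_null_sets)
  ultimately show ?thesis using U(2) by (intro bexI[of _ "?U \<union> F ` N"]) auto
qed

text \<open>A witness interval serves all of its points, since \<open>P\<close> mentions only the
  endpoints. This makes the exceptional sets below Borel, and is the reason for measuring slopes
  over intervals around \<open>x\<close> rather than from \<open>x\<close>.\<close>

lemma open_ex_interval: "open {x::real. \<exists>a b. a < x \<and> x < b \<and> P a b}"
proof (subst open_subopen, intro ballI)
  fix x assume "x \<in> {x::real. \<exists>a b. a < x \<and> x < b \<and> P a b}"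
  then obtain a b where ab: "a < x" "x < b" "P a b" by blast
  show "\<exists>T. open T \<and> x \<in> T \<and> T \<subseteq> {x. \<exists>a b. a < x \<and> x < b \<and> P a b}"
  proof (intro exI[of _ "{a<..<b}"] conjI subsetI)
    fix y assume "y \<in> {a<..<b}"
    then have "a < y" "y < b" by simp_all
    with ab(3) show "y \<in> {x. \<exists>a b. a < x \<and> x < b \<and> P a b}" by blast
  qed (use ab in simp_all)
qed

text \<open>A small quotient only gives an interval with \<open>x\<close> as an endpoint. The
  inequalities are strict and \<open>F\<close> is continuous, so both ends can be pushed outwards by
  a small \<open>\<eta>\<close>, which makes \<open>x\<close> interior.\<close>

lemma frequently_at_interval:
  fixes F :: "real \<Rightarrow> real"
  assumes cont: "continuous_on UNIV F" and "0 < e"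
    and freq: "\<exists>\<^sub>F h in at 0. (F (x + h) - F x) / h < p"
  shows "\<exists>a b. a < x \<and> x < b \<and> b - a < e \<and> F b - F a < p * (b - a)"
proof -
  have "\<forall>\<^sub>F h in at (0::real). h \<noteq> 0 \<and> \<bar>h\<bar> < e"
    using \<open>0 < e\<close> by (auto simp: eventually_at intro!: exI[of _ e])
  from frequently_ex[OF frequently_eventually_conj[OF freq this]]
  obtain h where h: "h \<noteq> 0" "\<bar>h\<bar> < e" "(F (x + h) - F x) / h < p"
    by blast
  define a0 b0 where "a0 = min x (x + h)" and "b0 = max x (x + h)"
  have ab: "a0 \<le> x" "x \<le> b0" "b0 - a0 < e" "F b0 - F a0 < p * (b0 - a0)"
  proof -
    show "F b0 - F a0 < p * (b0 - a0)"
      using h by (cases "h > 0") (auto simp: a0_def b0_def pos_divide_less_eq neg_divide_less_eq)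
  qed (use h in \<open>auto simp: a0_def b0_def\<close>)
  have FT: "((\<lambda>\<eta>. F (y \<eta>)) \<longlongrightarrow> F z) (at_right 0)" if "(y \<longlongrightarrow> z) (at_right 0)" for y :: "real \<Rightarrow> real" and z
    using continuous_on_tendsto_compose[OF cont that] by simp
  have lim1: "((\<lambda>\<eta>. (F (b0 + \<eta>) - F (a0 - \<eta>)) - p * ((b0 + \<eta>) - (a0 - \<eta>))) \<longlongrightarrow>
      (F (b0 + 0) - F (a0 - 0)) - p * ((b0 + 0) - (a0 - 0))) (at_right 0)"
    by (intro tendsto_diff FT tendsto_mult tendsto_add tendsto_const tendsto_ident_at)
  have lim2: "((\<lambda>\<eta>. (b0 + \<eta>) - (a0 - \<eta>)) \<longlongrightarrow> (b0 + 0) - (a0 - 0)) (at_right 0)"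
    by (intro tendsto_intros)
  have "\<forall>\<^sub>F \<eta> in at_right (0::real). 0 < \<eta> \<and> (F (b0 + \<eta>) - F (a0 - \<eta>)) - p * ((b0 + \<eta>) - (a0 - \<eta>)) < 0
      \<and> (b0 + \<eta>) - (a0 - \<eta>) < e"
    using ab by (intro eventually_conj order_tendstoD(2)[OF lim1] order_tendstoD(2)[OF lim2] eventually_at_right_less) simp_all
  from eventually_happens[OF this]
  obtain \<eta> where "0 < \<eta>" "(F (b0 + \<eta>) - F (a0 - \<eta>)) - p * ((b0 + \<eta>) - (a0 - \<eta>)) < 0"
      "(b0 + \<eta>) - (a0 - \<eta>) < e"
    by (metis trivial_limit_at_right_real)
  then show ?thesis using ab by (intro exI[of _ "a0 - \<eta>"] exI[of _ "b0 + \<eta>"]) auto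
qed

text \<open>Differentiability at \<open>x\<close> fails only if two distinct rational slopes are both crossed by
  arbitrarily short intervals around \<open>x\<close>; comparing the measure of such a set with that of
  its image under the bi-Lipschitz map \<open>F\<close> in both directions forces measure zero.\<close>

lemma increasing_bilipschitz_negligible_nondifferentiable:
  fixes F :: "real \<Rightarrow> real"
  assumes lip: "L-lipschitz_on UNIV F" and slope1: "\<And>x y. x \<le> y \<Longrightarrow> y - x \<le> F y - F x"
  shows "negligible {x. \<not> F differentiable (at x)}"
proof -
  have cont: "continuous_on UNIV F" using lip by (rule lipschitz_on_continuous_on)
  have mono: "mono F" using slope1 by (intro monoI) (smt (verit))
  have inj: "F x = F y \<longleftrightarrow> x = y" for x y
    using slope1[of x y] slope1[of y x] by linarith
  have surj: "\<exists>x. F x = y" for y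
  proof -
    have "\<exists>x\<ge>-\<bar>y - F 0\<bar>. x \<le> \<bar>y - F 0\<bar> \<and> F x = y"
      using slope1[of 0 "\<bar>y - F 0\<bar>"] slope1[of "-\<bar>y - F 0\<bar>" 0]
      by (intro IVT') (auto intro: continuous_on_subset[OF cont])
    then show ?thesis by blast
  qed
  define G where "G = inv F"
  have FG: "F (G y) = y" for y
    unfolding G_def by (rule f_inv_into_f) (use surj in \<open>metis rangeI\<close>)
  have GF: "G (F x) = x" for x
    using FG[of "F x"] inj by blast
  have monoG: "mono G"
  proof (rule monoI)
    fix x y :: real assume "x \<le> y"
    show "G x \<le> G y"
      using slope1[of "G y" "G x"] \<open>x \<le> y\<close> FG by (smt (verit))
  qed
  have lipG: "1-lipschitz_on UNIV G"
  proof (rule lipschitz_onI)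
    fix x y
    show "dist (G x) (G y) \<le> 1 * dist x y"
      using slope1[of "G x" "G y"] slope1[of "G y" "G x"] linear[of "G x" "G y"]
      unfolding FG dist_real_def by (smt (verit))
  qed simp
  define S where "S = (\<lambda>p q. {x. \<forall>n::nat. (\<exists>a b. a < x \<and> x < b \<and> b - a < 1 / Suc n \<and> F b - F a < p * (b - a))
      \<and> (\<exists>a b. a < x \<and> x < b \<and> b - a < 1 / Suc n \<and> q * (b - a) < F b - F a)})"
  have Sb: "S p q \<in> sets lebesgue" for p q
  proof -
    let ?A = "\<lambda>n::nat. {x. \<exists>a b. a < x \<and> x < b \<and> b - a < 1 / Suc n \<and> F b - F a < p * (b - a)}
        \<inter> {x. \<exists>a b. a < x \<and> x < b \<and> b - a < 1 / Suc n \<and> q * (b - a) < F b - F a}"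
    have "?A n \<in> sets borel" for n
      by (rule borel_open[OF open_Int[OF open_ex_interval open_ex_interval]])
    then have "(\<Inter>n. ?A n) \<in> sets borel"
      by (intro sets.countable_INT) auto
    moreover have "S p q = (\<Inter>n. ?A n)"
      unfolding S_def by blast
    ultimately show ?thesis by simp
  qed
  have null: "negligible (S p q)" if "0 < p" "p < q" for p q
  proof -
    \<comment> \<open>Bounded pieces have finite measure, so that \<open>m\<close> can be cancelled
      below.\<close>
    have "negligible (S p q \<inter> cball 0 R)" for R
    proof -
      let ?S = "S p q \<inter> cball 0 R"
      have Sm: "?S \<in> lmeasurable"
        using Sb by (simp add: fmeasurable_Int_fmeasurable inf_commute)
      define m where "m = measure lebesgue ?S"
      \<comment> \<open>A round trip: \<open>F\<close> stretches \<open>?S\<close> by at most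
        \<open>p\<close>, and its inverse \<open>G\<close> stretches the image by at most
        \<open>1 / q\<close>, ending in a set that contains \<open>?S\<close>. Each open superset
        costs \<open>e\<close>. Letting \<open>e\<close> tend to \<open>0\<close> gives
        \<open>q * m \<le> p * m\<close>, hence \<open>m = 0\<close>.\<close>
      have m_le: "q * m \<le> p * (m + e) + e" if "0 < e" for e
      proof -
        obtain A where A: "open A" "?S \<subseteq> A" "A \<in> lmeasurable" "measure lebesgue A < m + e"
          using lmeasurable_outer_open[OF Sm \<open>0 < e\<close>] unfolding m_def by blast
        obtain T where T: "T \<in> lmeasurable" "F ` ?S \<subseteq> T" "measure lebesgue T \<le> p * measure lebesgue A"
        proof -
          have "\<exists>a b. a < x \<and> x < b \<and> b - a < d \<and> F b - F a \<le> p * (b - a)" if "x \<in> ?S" "0 < d" for x d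
          proof -
            obtain n :: nat where n: "1 / Suc n < d" using nat_approx_posE[OF \<open>0 < d\<close>] by auto
            obtain a b where "a < x \<and> x < b \<and> b - a < 1 / Suc n \<and> F b - F a < p * (b - a)"
              using \<open>x \<in> ?S\<close> unfolding S_def by blast
            with n show ?thesis by (intro exI[of _ a] exI[of _ b]) auto
          qed
          from image_subset_measure_le_slope[OF lip mono _ A(1,3,2) this]
          show thesis using that \<open>0 < p\<close> by auto
        qed
        obtain B where B: "open B" "T \<subseteq> B" "B \<in> lmeasurable" "measure lebesgue B < measure lebesgue T + e"
          using lmeasurable_outer_open[OF T(1) \<open>0 < e\<close>] by blast
        obtain V where V: "V \<in> lmeasurable" "G ` F ` ?S \<subseteq> V" "measure lebesgue V \<le> 1 / q * measure lebesgue B"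
        proof -
          have "\<exists>a b. a < y \<and> y < b \<and> b - a < d \<and> G b - G a \<le> 1/q * (b - a)"
            if y: "y \<in> F ` ?S" and "0 < d" for y d
          proof -
            obtain x where x: "x \<in> ?S" "y = F x" using y by blast
            \<comment> \<open>\<open>F\<close> lengthens intervals by at most the factor
              \<open>L\<close>, so this scale keeps the image intervals shorter than
              \<open>d\<close>.\<close>
            have "0 < d / (\<bar>L\<bar> + 1)" using \<open>0 < d\<close> by simp
            then obtain n :: nat where n: "1 / Suc n < d / (\<bar>L\<bar> + 1)" using nat_approx_posE by blast
            obtain a b where ab: "a < x" "x < b" "b - a < 1 / Suc n" "q * (b - a) < F b - F a"
              using x(1) unfolding S_def by blast
            have "F b - F a \<le> L * (b - a)"
              using lipschitz_onD[OF lip, of a b] ab by (auto simp: dist_real_def)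
            also have "\<dots> \<le> (\<bar>L\<bar> + 1) * (b - a)"
              using ab by (intro mult_right_mono) auto
            also have "\<dots> < d"
              using less_trans[OF ab(3) n] by (simp add: field_simps)
            finally show ?thesis
              using ab slope1[of a x] slope1[of x b] \<open>0 < p\<close> \<open>p < q\<close> x
              by (intro exI[of _ "F a"] exI[of _ "F b"]) (auto simp: GF field_simps)
          qed
          from image_subset_measure_le_slope[OF lipG monoG _ B(1,3) order_trans[OF T(2) B(2)] this]
          show thesis using that \<open>0 < p\<close> \<open>p < q\<close> by auto
        qed
        have "?S \<subseteq> V" using V(2) by (auto simp: image_image GF)
        then have "m \<le> measure lebesgue V"
          unfolding m_def using V(1) Sm by (intro measure_mono_fmeasurable) auto
        also note V(3)
        finally have "q * m \<le> measure lebesgue B"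
          using \<open>0 < p\<close> \<open>p < q\<close> by (simp add: field_simps)
        also have "\<dots> \<le> p * (m + e) + e"
          using B(4) T(3) A(4) mult_left_mono[of "measure lebesgue A" "m + e" p] \<open>0 < p\<close> by linarith
        finally show ?thesis .
      qed
      have "q * m - p * m \<le> 0 + d" if "0 < d" for d
      proof -
        \<comment> \<open>\<open>e = d / (p + 1)\<close> is the solution of
          \<open>p * e + e = d\<close>.\<close>
        have "p * (d / (p + 1)) + d / (p + 1) = d"
          using \<open>0 < p\<close> by (simp add: add_divide_distrib[symmetric] distrib_right[symmetric] field_simps)
        then show ?thesis
          using m_le[of "d / (p + 1)"] that \<open>0 < p\<close> by (simp add: distrib_left)
      qed
      then have "(q - p) * m \<le> 0"
        using field_le_epsilon[of "q * m - p * m" 0] by (simp add: algebra_simps)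
      moreover have "0 \<le> m" by (simp add: m_def)
      ultimately have "m = 0" using \<open>p < q\<close> by (simp add: mult_le_0_iff)
      then show ?thesis using Sm by (simp add: m_def negligible_iff_measure)
    qed
    then have "negligible (\<Union>k::nat. S p q \<inter> cball 0 (real k))"
      by (intro negligible_countable_Union) auto
    moreover have "S p q = (\<Union>k::nat. S p q \<inter> cball 0 (real k))"
      using real_arch_simple by (force simp: dist_real_def)
    ultimately show ?thesis by simp
  qed
  have "{x. \<not> F differentiable (at x)} \<subseteq> (\<Union>(p, q)\<in>{(p, q). p \<in> \<rat> \<and> q \<in> \<rat> \<and> 0 < p \<and> p < q}. S p q)"
  proof clarify
    fix x assume nd: "\<not> F differentiable (at x)"
    define \<phi> where "\<phi> = (\<lambda>h. (F (x + h) - F x) / h)"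
    have nolim: "\<not> ((\<lambda>h. ereal (\<phi> h)) \<longlongrightarrow> ereal D) (at 0)" for D
      using nd by (auto simp: \<phi>_def DERIV_def real_differentiable_def)
    have bnd: "1 \<le> \<phi> h \<and> \<phi> h \<le> L" if "h \<noteq> 0" for h
      using that slope1[of x "x + h"] slope1[of "x + h" x] lipschitz_onD[OF lip, of "x + h" x]
      by (auto simp: \<phi>_def dist_real_def field_simps abs_if split: if_splits)
    have ev: "\<forall>\<^sub>F h in at 0. P (\<phi> h)" if "\<And>y. 1 \<le> y \<Longrightarrow> y \<le> L \<Longrightarrow> P y" for P
      using that bnd by (auto simp: eventually_at_filter)
    \<comment> \<open>All quotients lie between \<open>1\<close> and \<open>L\<close>, so these
      extended reals are finite. Without a derivative they must differ, which leaves room for two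
      rationals strictly between them.\<close>
    let ?l = "Liminf (at 0) (\<lambda>h. ereal (\<phi> h))" and ?u = "Limsup (at 0) (\<lambda>h. ereal (\<phi> h))"
    have l1: "1 \<le> ?l" by (rule Liminf_bounded) (auto intro: ev)
    have uL: "?u \<le> ereal L" by (rule Limsup_bounded) (auto intro: ev)
    have lu: "?l \<le> ?u" by (rule Liminf_le_Limsup) auto
    have "?l \<noteq> ?u"
    proof
      assume eq: "?l = ?u"
      then obtain D where D: "?u = ereal D"
        using l1 uL by (cases "?u") auto
      have "((\<lambda>h. ereal (\<phi> h)) \<longlongrightarrow> ereal D) (at 0)"
        using eq D by (intro Liminf_eq_Limsup) auto
      then show False using nolim by blast
    qed
    with lu have "?l < ?u" by simp
    then obtain z where z: "?l < ereal z" "ereal z < ?u"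
      using ereal_dense2 by blast
    obtain z' where z': "z < z'" "ereal z' < ?u"
      using z(2) ereal_dense2 by force
    obtain p q where pq: "p \<in> \<rat>" "q \<in> \<rat>" "z < p" "p < q" "q < z'"
      using Rats_dense_in_real[OF \<open>z < z'\<close>] Rats_dense_in_real by metis
    have fp: "\<exists>\<^sub>F h in at 0. \<phi> h < p"
    proof (rule ccontr)
      assume "\<not> ?thesis"
      then have "\<forall>\<^sub>F h in at 0. ereal p \<le> ereal (\<phi> h)"
        by (simp add: not_frequently not_less)
      then have "ereal p \<le> ?l" by (rule Liminf_bounded)
      then show False using z(1) pq(3) by (meson ereal_less_ereal_Ex less_ereal.simps(1) not_le order_less_le_trans order_less_trans)
    qed
    have fq: "\<exists>\<^sub>F h in at 0. q < \<phi> h"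
    proof (rule ccontr)
      assume "\<not> ?thesis"
      then have "\<forall>\<^sub>F h in at 0. ereal (\<phi> h) \<le> ereal q"
        by (simp add: not_frequently not_less)
      then have "?u \<le> ereal q" by (rule Limsup_bounded)
      then show False using z'(2) pq(5) by (meson less_ereal.simps(1) not_le order_less_le_trans order_less_trans)
    qed
    have "1 < z" using l1 z(1) by (metis ereal_less(3) less_ereal.simps(1) one_ereal_def order_le_less_trans)
    have "x \<in> S p q"
    proof -
      have 1: "\<exists>a b. a < x \<and> x < b \<and> b - a < 1 / Suc n \<and> F b - F a < p * (b - a)" for n :: nat
        using frequently_at_interval[OF cont, of "1 / Suc n" x p] fp by (auto simp: \<phi>_def)
      have "(- F (x + h) - - F x) / h = - \<phi> h" for h
        by (simp add: \<phi>_def diff_divide_distrib)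
      then have "\<exists>\<^sub>F h in at 0. (- F (x + h) - - F x) / h < - q"
        using fq by simp
      then have "\<exists>a b. a < x \<and> x < b \<and> b - a < 1 / Suc n \<and> - F b - - F a < - q * (b - a)" for n :: nat
        by (intro frequently_at_interval continuous_on_minus cont) auto
      then have 2: "\<exists>a b. a < x \<and> x < b \<and> b - a < 1 / Suc n \<and> q * (b - a) < F b - F a" for n :: nat
        by (simp add: algebra_simps) 
      show ?thesis using 1 2 by (simp add: S_def)
    qed
    moreover have "0 < p" using pq \<open>1 < z\<close> by linarith
    ultimately show "x \<in> (\<Union>(p, q)\<in>{(p, q). p \<in> \<rat> \<and> q \<in> \<rat> \<and> 0 < p \<and> p < q}. S p q)"
      using pq by blast
  qed
  moreover have "negligible (\<Union>(p, q)\<in>{(p, q). p \<in> \<rat> \<and> q \<in> \<rat> \<and> 0 < p \<and> p < q}. S p q)"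
  proof (rule negligible_countable_Union)
    have "countable ((\<rat> :: real set) \<times> (\<rat> :: real set))"
      using countable_rat by auto
    then show "countable ((\<lambda>(p, q). S p q) ` {(p, q). p \<in> \<rat> \<and> q \<in> \<rat> \<and> 0 < p \<and> p < q})"
      by (intro countable_image) (auto elim!: countable_subset[rotated])
  qed (use null in auto)
  ultimately show ?thesis by (rule negligible_subset[rotated])
qed

text \<open>Adding \<open>(L + 1) * x\<close> raises every slope to at least \<open>1\<close> and
  leaves the set of nondifferentiability unchanged.\<close>

lemma lipschitz_real_negligible_nondifferentiable:
  fixes f :: "real \<Rightarrow> real"
  assumes lip: "L-lipschitz_on UNIV f"
  shows "negligible {x. \<not> f differentiable (at x)}"
proof -
  let ?F = "\<lambda>x. f x + (L + 1) * x"
  have L: "0 \<le> L" using lip by (rule lipschitz_on_nonneg)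
  have "(L + (L + 1))-lipschitz_on UNIV ?F"
    using L by (intro lipschitz_on_add lip lipschitz_onI) (auto simp: dist_real_def abs_mult simp flip: right_diff_distrib)
  moreover have "y - x \<le> ?F y - ?F x" if "x \<le> y" for x y
    using lipschitz_onD[OF lip, of x y] that by (auto simp: dist_real_def algebra_simps)
  ultimately have "negligible {x. \<not> ?F differentiable (at x)}"
    by (rule increasing_bilipschitz_negligible_nondifferentiable)
  moreover have "f differentiable (at x)" if "?F differentiable (at x)" for x
  proof -
    have "(\<lambda>x. ?F x - (L + 1) * x) differentiable (at x)"
      by (intro differentiable_diff that differentiable_mult) auto
    then show ?thesis by simp
  qed
  ultimately show ?thesis by (auto elim: negligible_subset)
qed

section \<open>Rademacher's theorem\<close>

text \<open>Fubini without a change of coordinates: translation by \<open>s *\<^sub>R v\<close>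
  preserves the measure of \<open>N\<close>, so averaging the translates over
  \<open>s \<in> {0..1}\<close> returns it. Exchanging the integrals expresses the same number by
  the lengths of slices of \<open>N\<close> along lines in direction \<open>v\<close>, which all
  vanish.\<close>

lemma AE_lborel_lineI:
  fixes N :: "'a::euclidean_space set"
  assumes N[measurable]: "N \<in> sets borel"
    and line: "\<And>x. negligible {s::real. x + s *\<^sub>R v \<in> N}"
  shows "AE x in lborel. x \<notin> N"
proof -
  have [measurable]: "{s::real. x + s *\<^sub>R v \<in> N} \<in> sets borel" for x
  proof -
    have "(\<lambda>s::real. x + s *\<^sub>R v) \<in> borel_measurable borel" by measurable
    from measurable_sets[OF this N] show ?thesis by (simp add: vimage_def)
  qed
  have m: "(\<lambda>(x, s). indicator N (x + s *\<^sub>R v) * indicator {0..1::real} s :: ennreal)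
      \<in> borel_measurable (lborel \<Otimes>\<^sub>M lborel)"
    by measurable
  have "emeasure lborel N = (\<integral>\<^sup>+ x. indicator N x \<partial>lborel)"
    by simp
  also have "\<dots> = (\<integral>\<^sup>+ s. (\<integral>\<^sup>+ x. indicator N x \<partial>lborel) * indicator {0..1::real} s \<partial>lborel)"
    by (subst nn_integral_cmult) auto
  also have "\<dots> = (\<integral>\<^sup>+ s. (\<integral>\<^sup>+ x. indicator N (x + s *\<^sub>R v) * indicator {0..1::real} s \<partial>lborel) \<partial>lborel)"
  proof (rule nn_integral_cong)
    fix s :: real
    have "(\<integral>\<^sup>+ x. indicator N x \<partial>lborel) = (\<integral>\<^sup>+ x. indicator N x \<partial>distr lborel borel ((+) (s *\<^sub>R v)))"
      by (simp add: lborel_distr_plus)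
    also have "\<dots> = (\<integral>\<^sup>+ x. indicator N (x + s *\<^sub>R v) \<partial>lborel)"
      by (subst nn_integral_distr) (auto simp: add.commute)
    finally show "(\<integral>\<^sup>+ x. indicator N x \<partial>lborel) * indicator {0..1} s
        = (\<integral>\<^sup>+ x. indicator N (x + s *\<^sub>R v) * indicator {0..1::real} s \<partial>lborel)"
      by (subst nn_integral_multc) auto
  qed
  also have "\<dots> = (\<integral>\<^sup>+ x. (\<integral>\<^sup>+ s. indicator N (x + s *\<^sub>R v) * indicator {0..1::real} s \<partial>lborel) \<partial>lborel)"
    by (rule lborel_pair.Fubini'[OF m])
  also have "\<dots> = (\<integral>\<^sup>+ x. 0 \<partial>(lborel :: 'a measure))"
  proof (rule nn_integral_cong)
    fix x :: 'a
    have "emeasure lborel {s::real. x + s *\<^sub>R v \<in> N} = 0"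
      using line[of x] by (simp add: negligible_iff_emeasure0)
    moreover have "(\<integral>\<^sup>+ s. indicator N (x + s *\<^sub>R v) * indicator {0..1::real} s \<partial>lborel)
        \<le> (\<integral>\<^sup>+ s. indicator {s::real. x + s *\<^sub>R v \<in> N} s \<partial>lborel)"
      by (rule nn_integral_mono) (auto simp: indicator_def)
    ultimately show "(\<integral>\<^sup>+ s. indicator N (x + s *\<^sub>R v) * indicator {0..1::real} s \<partial>lborel) = 0"
      by simp
  qed
  finally have "N \<in> null_sets lborel"
    by (intro null_setsI) auto
  then show ?thesis by (rule AE_not_in)
qed

section \<open>Directional derivatives of real-valued Lipschitz functions\<close>

definition dquot :: "('a::real_vector \<Rightarrow> real) \<Rightarrow> 'a \<Rightarrow> nat \<Rightarrow> 'a \<Rightarrow> real" where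
  "dquot f v n x = (f (x + (1 / Suc n) *\<^sub>R v) - f x) * real (Suc n)"

text \<open>Using only the steps \<open>1 / Suc n\<close> makes convergence a countable condition,
  so measurability is immediate for continuous \<open>f\<close>. The Cauchy test with default value
  \<open>0\<close> keeps the function total and preserves the Lipschitz bound at every
  point.\<close>

definition dirderiv :: "('a::real_vector \<Rightarrow> real) \<Rightarrow> 'a \<Rightarrow> 'a \<Rightarrow> real" where
  "dirderiv f v x = (if Cauchy (\<lambda>n. dquot f v n x) then lim (\<lambda>n. dquot f v n x) else 0)"

lemma dquot_bound:
  fixes f :: "'a::real_normed_vector \<Rightarrow> real"
  assumes "L-lipschitz_on UNIV f"
  shows "\<bar>dquot f v n x\<bar> \<le> L * norm v"
proof -
  have "\<bar>f (x + (1 / Suc n) *\<^sub>R v) - f x\<bar> \<le> L * (norm v / Suc n)"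
    using lipschitz_onD[OF assms, of "x + (1 / Suc n) *\<^sub>R v" x] by (simp add: dist_norm)
  then have "\<bar>f (x + (1 / Suc n) *\<^sub>R v) - f x\<bar> * real (Suc n) \<le> L * (norm v / real (Suc n)) * real (Suc n)"
    by (intro mult_right_mono) auto
  then show ?thesis by (simp add: dquot_def abs_mult)
qed

lemma dirderiv_tendsto:
  "Cauchy (\<lambda>n. dquot f v n x) \<Longrightarrow> (\<lambda>n. dquot f v n x) \<longlonglongrightarrow> dirderiv f v x"
  by (simp add: dirderiv_def Cauchy_convergent_iff convergent_LIMSEQ_iff)

lemma dirderiv_eqI:
  assumes "(\<lambda>n. dquot f v n x) \<longlonglongrightarrow> d" shows "dirderiv f v x = d"
  using assms LIMSEQ_imp_Cauchy[OF assms] by (simp add: dirderiv_def limI)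

lemma dirderiv_bound:
  fixes f :: "'a::real_normed_vector \<Rightarrow> real"
  assumes "L-lipschitz_on UNIV f"
  shows "\<bar>dirderiv f v x\<bar> \<le> L * norm v"
proof (cases "Cauchy (\<lambda>n. dquot f v n x)")
  case True
  then show ?thesis
    using tendsto_rabs[OF dirderiv_tendsto[OF True]] dquot_bound[OF assms]
    by (intro LIMSEQ_le_const2) auto
qed (use lipschitz_on_nonneg[OF assms] in \<open>simp add: dirderiv_def\<close>)

lemma borel_measurable_dquot:
  fixes f :: "'a::euclidean_space \<Rightarrow> real"
  assumes "L-lipschitz_on UNIV f"
  shows "dquot f v n \<in> borel_measurable borel"
proof -
  have [measurable]: "f \<in> borel_measurable borel"
    using lipschitz_on_continuous_on[OF assms] by (rule borel_measurable_continuous_onI)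
  show ?thesis unfolding dquot_def by measurable
qed

lemma borel_measurable_dirderiv:
  fixes f :: "'a::euclidean_space \<Rightarrow> real"
  assumes "L-lipschitz_on UNIV f"
  shows "dirderiv f v \<in> borel_measurable borel"
proof -
  note [measurable] = borel_measurable_dquot[OF assms]
  show ?thesis unfolding dirderiv_def by measurable
qed

text \<open>On each line in direction \<open>v\<close> the function is a Lipschitz function of one
  variable, hence differentiable off a null set of parameters; slicing turns these into a null set
  of base points.\<close>

lemma AE_dquot_tendsto:
  fixes f :: "'a::euclidean_space \<Rightarrow> real"
  assumes lip: "L-lipschitz_on UNIV f"
  shows "AE x in lborel. (\<lambda>n. dquot f v n x) \<longlonglongrightarrow> dirderiv f v x"
proof -
  note [measurable] = borel_measurable_dquot[OF lip]
  have "AE x in lborel. x \<notin> {x. \<not> Cauchy (\<lambda>n. dquot f v n x)}"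
  proof (rule AE_lborel_lineI)
    have "{x \<in> space borel. Cauchy (\<lambda>n. dquot f v n x)} \<in> sets borel" by measurable
    then have "UNIV - {x \<in> space borel. Cauchy (\<lambda>n. dquot f v n x)} \<in> sets borel" by auto
    then show "{x. \<not> Cauchy (\<lambda>n. dquot f v n x)} \<in> sets borel"
      by (simp add: set_diff_eq)
    fix x
    let ?\<phi> = "\<lambda>s. f (x + s *\<^sub>R v)"
    have "(L * norm v)-lipschitz_on UNIV ?\<phi>"
    proof (rule lipschitz_onI)
      fix s t :: real
      have "dist (?\<phi> s) (?\<phi> t) \<le> L * dist (x + s *\<^sub>R v) (x + t *\<^sub>R v)"
        by (rule lipschitz_onD[OF lip]) auto
      also have "\<dots> = L * norm v * dist s t"
        by (simp add: dist_norm scaleR_diff_left[symmetric])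
      finally show "dist (?\<phi> s) (?\<phi> t) \<le> L * norm v * dist s t" .
    qed (use lipschitz_on_nonneg[OF lip] in simp)
    then have "negligible {s. \<not> ?\<phi> differentiable (at s)}"
      by (rule lipschitz_real_negligible_nondifferentiable)
    moreover have "Cauchy (\<lambda>n. dquot f v n (x + s *\<^sub>R v))" if diff: "?\<phi> differentiable (at s)" for s
    proof -
      obtain D where "(?\<phi> has_real_derivative D) (at s)"
        using diff by (auto simp: real_differentiable_def)
      then have "((\<lambda>h. (?\<phi> (s + h) - ?\<phi> s) / h) \<longlongrightarrow> D) (at 0)"
        by (simp add: DERIV_def)
      moreover have "filterlim (\<lambda>n. 1 / real (Suc n)) (at 0) sequentially"
        using LIMSEQ_Suc[OF lim_1_over_n] by (auto simp: filterlim_at)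
      ultimately have "(\<lambda>n. (?\<phi> (s + 1 / real (Suc n)) - ?\<phi> s) / (1 / real (Suc n))) \<longlonglongrightarrow> D"
        by (rule filterlim_compose)
      then have "(\<lambda>n. dquot f v n (x + s *\<^sub>R v)) \<longlonglongrightarrow> D"
        by (simp add: dquot_def scaleR_add_left add.assoc)
      then show ?thesis by (rule LIMSEQ_imp_Cauchy)
    qed
    ultimately show "negligible {s. x + s *\<^sub>R v \<in> {x. \<not> Cauchy (\<lambda>n. dquot f v n x)}}"
      by (auto elim: negligible_subset)
  qed
  then show ?thesis by (auto elim!: AE_mp intro: dirderiv_tendsto)
qed

text \<open>Adding \<open>M\<close> makes \<open>F\<close> a nonnegative density. The measures with
  densities \<open>F + M\<close> and \<open>M\<close> agree on boxes, an intersection-stable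
  generator of the Borel sets, so they are equal and their densities agree almost
  everywhere.\<close>

lemma AE_eq_0_if_integral_box_eq_0:
  fixes F :: "'a::euclidean_space \<Rightarrow> real"
  assumes F[measurable]: "F \<in> borel_measurable borel" and bnd: "\<And>x. \<bar>F x\<bar> \<le> M"
    and int0: "\<And>a b. (\<integral>x. indicator (box a b) x * F x \<partial>lborel) = 0"
  shows "AE x in lborel. F x = 0"
proof -
  have "density lborel (\<lambda>x. ennreal (F x + M)) = density lborel (\<lambda>x. ennreal M)"
  proof (rule measure_eqI_generator_eq)
    let ?E = "range (\<lambda>(a, b). box a b::'a set)"
    show "Int_stable ?E"
      by (auto simp: Int_stable_def box_Int_box)
    show "?E \<subseteq> Pow UNIV" "sets (density lborel (\<lambda>x. ennreal (F x + M))) = sigma_sets UNIV ?E"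
      "sets (density lborel (\<lambda>x::'a. ennreal M)) = sigma_sets UNIV ?E"
      by (simp_all add: borel_eq_box)
    let ?A = "\<lambda>n::nat. box (- (real n *\<^sub>R One)) (real n *\<^sub>R One) :: 'a set"
    show "range ?A \<subseteq> ?E" "(\<Union>i. ?A i) = UNIV"
      unfolding UN_box_eq_UNIV by auto
    have eq: "emeasure (density lborel (\<lambda>x. ennreal (F x + M))) (box a b) = ennreal M * emeasure lborel (box a b)" for a b
    proof -
      have nonneg: "0 \<le> F x + M" for x using bnd[of x] by linarith
      have M0: "0 \<le> M" using bnd[of 0] by linarith
      have i1: "integrable lborel (\<lambda>x::'a. indicator (box a b) x * M)"
        by (intro integrable_mult_left integrable_real_indicator emeasure_bounded_finite) auto
      have i2: "integrable lborel (\<lambda>x. indicator (box a b) x * F x)"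
        by (rule Bochner_Integration.integrable_bound[OF i1]) (use bnd M0 in \<open>auto simp: indicator_def\<close>)
      have "emeasure (density lborel (\<lambda>x. ennreal (F x + M))) (box a b)
          = (\<integral>\<^sup>+x. ennreal (F x + M) * indicator (box a b) x \<partial>lborel)"
        by (rule emeasure_density) auto
      also have "\<dots> = (\<integral>\<^sup>+x. ennreal (indicator (box a b) x * F x + indicator (box a b) x * M) \<partial>lborel)"
        by (rule nn_integral_cong) (auto simp: indicator_def)
      also have "\<dots> = ennreal (\<integral>x. indicator (box a b) x * F x + indicator (box a b) x * M \<partial>lborel)"
        using nonneg by (intro nn_integral_eq_integral Bochner_Integration.integrable_add i1 i2) (auto simp: indicator_def)
      also have "(\<integral>x. indicator (box a b) x * F x + indicator (box a b) x * M \<partial>lborel)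
          = M * measure lborel (box a b)"
        using Bochner_Integration.integral_add[OF i2 i1] by (simp add: int0)
      also have "ennreal \<dots> = ennreal M * emeasure lborel (box a b)"
        using M0 emeasure_bounded_finite[OF bounded_box[of a b]]
        by (subst emeasure_eq_ennreal_measure) (auto simp: ennreal_mult)
      finally show ?thesis .
    qed
    show "emeasure (density lborel (\<lambda>x. ennreal (F x + M))) (?A i) \<noteq> \<infinity>" for i
      unfolding eq by (simp add: ennreal_mult_eq_top_iff)
    show "emeasure (density lborel (\<lambda>x. ennreal (F x + M))) X = emeasure (density lborel (\<lambda>x. ennreal M)) X" if "X \<in> ?E" for X
      using that by (auto simp: eq emeasure_density nn_integral_cmult)
  qed
  then have "AE x in lborel. ennreal (F x + M) = ennreal M"
    by (subst (asm) sigma_finite_measure.density_unique_iff[OF sigma_finite_lborel]) auto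
  then show ?thesis
  proof (rule AE_mp, intro AE_I2 impI)
    fix x assume "ennreal (F x + M) = ennreal M"
    then show "F x = 0" using bnd[of x] by (subst (asm) ennreal_inj) auto
  qed
qed

text \<open>Quotients are additive up to a shifted base point: the one for \<open>v + w\<close> at
  \<open>x\<close> is the one for \<open>v\<close> at \<open>x + c n\<close> plus the one for
  \<open>w\<close> at \<open>x\<close>. Under an integral over a box, translation invariance moves
  the shift onto the box, where it disappears in the limit.\<close>

lemma AE_dirderiv_add:
  fixes f :: "'a::euclidean_space \<Rightarrow> real"
  assumes lip: "L-lipschitz_on UNIV f"
  shows "AE x in lborel. dirderiv f (v + w) x = dirderiv f v x + dirderiv f w x"
proof -
  note [measurable] = borel_measurable_dquot[OF lip] borel_measurable_dirderiv[OF lip]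
  let ?F = "\<lambda>x. dirderiv f (v + w) x - dirderiv f v x - dirderiv f w x"
  have "AE x in lborel. ?F x = 0"
  proof (rule AE_eq_0_if_integral_box_eq_0)
    show "\<bar>?F x\<bar> \<le> L * norm (v + w) + L * norm v + L * norm w" for x
      using dirderiv_bound[OF lip, of "v + w" x] dirderiv_bound[OF lip, of v x] dirderiv_bound[OF lip, of w x]
      by linarith
    fix a b :: 'a
    let ?Q = "box a b"
    obtain R where R: "?Q \<subseteq> cball 0 R"
      using bounded_subset_ballD[OF bounded_box[of a b], of 0] ball_subset_cball by blast
    \<comment> \<open>The moving box covers both uses, the shifted term and, with
      \<open>c = 0\<close>, the unshifted ones. \<open>C\<close> bounds the shifts so that a single
      ball dominates all integrands.\<close>
    have lim: "(\<lambda>n. \<integral>x. indicator ?Q (x - c n) * dquot f u n x \<partial>lborel)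
        \<longlonglongrightarrow> (\<integral>x. indicator ?Q x * dirderiv f u x \<partial>lborel)"
      if c: "c \<longlonglongrightarrow> 0" "\<And>n. norm (c n) \<le> C" for u and c :: "nat \<Rightarrow> 'a" and C
    proof (rule integral_dominated_convergence)
      show "integrable lborel (\<lambda>x::'a. indicator (cball 0 (R + C)) x * (L * norm u))"
        by (intro integrable_mult_left integrable_real_indicator emeasure_bounded_finite) auto
      show "AE x in lborel. norm (indicator ?Q (x - c n) * dquot f u n x) \<le> indicator (cball 0 (R + C)) x * (L * norm u)" for n
      proof (rule AE_I2)
        fix x
        have "norm x \<le> R + C" if "x - c n \<in> ?Q"
          using that R c(2)[of n] norm_triangle_ineq[of "x - c n" "c n"] by force
        then show "norm (indicator ?Q (x - c n) * dquot f u n x) \<le> indicator (cball 0 (R + C)) x * (L * norm u)"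
          using dquot_bound[OF lip, of u n x] lipschitz_on_nonneg[OF lip] by (auto simp: indicator_def)
      qed
      \<comment> \<open>Indicators of the shifted boxes converge except possibly on the boundary of
        the box, a null set.\<close>
      have "AE x in lborel. x \<notin> cbox a b - ?Q"
        using negligible_frontier_interval[of a b]
        by (intro AE_not_in) (auto simp: negligible_iff_emeasure0 null_sets_def)
      then show "AE x in lborel. (\<lambda>n. indicator ?Q (x - c n) * dquot f u n x) \<longlonglongrightarrow> indicator ?Q x * dirderiv f u x"
        using AE_dquot_tendsto[OF lip, of u]
      proof eventually_elim
        case (elim x)
        have xc: "(\<lambda>n. x - c n) \<longlonglongrightarrow> x"
          using tendsto_diff[OF tendsto_const c(1)] by simp
        have "\<forall>\<^sub>F n in sequentially. indicator ?Q (x - c n) = (indicator ?Q x :: real)"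
        proof (cases "x \<in> ?Q")
          case True
          then show ?thesis
            by (intro eventually_mono[OF topological_tendstoD[OF xc open_box True]]) simp
        next
          case False
          then have "x \<in> - cbox a b" using elim by auto
          then have "\<forall>\<^sub>F n in sequentially. x - c n \<in> - cbox a b"
            using topological_tendstoD[OF xc open_Compl[OF closed_cbox]] by auto
          then show ?thesis
            by eventually_elim (use False box_subset_cbox[of a b] in \<open>auto simp: indicator_def\<close>)
        qed
        then have "(\<lambda>n. indicator ?Q (x - c n)) \<longlonglongrightarrow> (indicator ?Q x :: real)"
          by (rule tendsto_eventually)
        then show ?case using elim by (intro tendsto_mult)
      qed
    qed measurable
    define c where "c = (\<lambda>n. (1 / real (Suc n)) *\<^sub>R w)"
    have "c \<longlonglongrightarrow> 0 *\<^sub>R w"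
      unfolding c_def using LIMSEQ_Suc[OF lim_1_over_n] by (intro tendsto_scaleR) auto
    then have c0: "c \<longlonglongrightarrow> 0" by simp
    have cb: "norm (c n) \<le> norm w" for n
      by (simp add: c_def divide_le_eq mult_le_cancel_left1)
    have int: "integrable lborel (\<lambda>x. indicator ?Q x * h x)" if [measurable]: "h \<in> borel_measurable borel" and "\<And>x. \<bar>h x\<bar> \<le> K" for h :: "'a \<Rightarrow> real" and K
    proof (rule Bochner_Integration.integrable_bound)
      show "integrable lborel (\<lambda>x::'a. indicator ?Q x * K)"
        by (intro integrable_mult_left integrable_real_indicator emeasure_bounded_finite) auto
      show "AE x in lborel. norm (indicator ?Q x * h x) \<le> norm (indicator ?Q x * K)"
        by (rule AE_I2) (use that(2) in \<open>fastforce simp: indicator_def intro: order_trans\<close>)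
    qed measurable
    have eq: "(\<integral>x. indicator ?Q x * dquot f (v + w) n x \<partial>lborel)
        = (\<integral>x. indicator ?Q (x - c n) * dquot f v n x \<partial>lborel) + (\<integral>x. indicator ?Q x * dquot f w n x \<partial>lborel)" for n
    proof -
      have "dquot f (v + w) n x = dquot f v n (x + c n) + dquot f w n x" for x
        by (simp add: dquot_def c_def algebra_simps)
      then have "(\<integral>x. indicator ?Q x * dquot f (v + w) n x \<partial>lborel)
          = (\<integral>x. indicator ?Q x * dquot f v n (x + c n) + indicator ?Q x * dquot f w n x \<partial>lborel)"
        by (simp add: algebra_simps)
      also have "\<dots> = (\<integral>x. indicator ?Q x * dquot f v n (x + c n) \<partial>lborel) + (\<integral>x. indicator ?Q x * dquot f w n x \<partial>lborel)"
        by (rule Bochner_Integration.integral_add[OF int[OF _ dquot_bound[OF lip]] int[OF _ dquot_bound[OF lip]]]) measurable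
      also have "(\<integral>x. indicator ?Q x * dquot f v n (x + c n) \<partial>lborel) = (\<integral>x. indicator ?Q (x - c n) * dquot f v n x \<partial>distr lborel borel ((+) (c n)))"
        by (subst integral_distr) (auto simp: add.commute)
      finally show ?thesis by (simp add: lborel_distr_plus)
    qed
    have "(\<lambda>n. \<integral>x. indicator ?Q (x - 0) * dquot f (v + w) n x \<partial>lborel) \<longlonglongrightarrow> (\<integral>x. indicator ?Q x * dirderiv f v x \<partial>lborel) + (\<integral>x. indicator ?Q x * dirderiv f w x \<partial>lborel)"
      using tendsto_add[OF lim[OF c0 cb] lim[of "\<lambda>_. 0" 0]] by (simp add: eq)
    from LIMSEQ_unique[OF this lim[of "\<lambda>_. 0" 0]]
    show "(\<integral>x. indicator ?Q x * ?F x \<partial>lborel) = 0"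
      using int[OF borel_measurable_dirderiv[OF lip] dirderiv_bound[OF lip]]
      by (simp add: right_diff_distrib)
  qed measurable
  then show ?thesis by (auto elim!: AE_mp)
qed

text \<open>Lipschitz continuity fills the gaps between the sampled steps. Let \<open>t\<close> be
  the largest sampled step strictly below \<open>s\<close>. Then \<open>s - t \<le> s * t\<close>,
  so moving the point and changing the divisor each alter the quotient by at most
  \<open>K * s\<close>.\<close>

lemma dquot_tendsto_at_right:
  fixes f :: "'a::real_normed_vector \<Rightarrow> real"
  assumes lip: "L-lipschitz_on UNIV f" and lim: "(\<lambda>n. dquot f v n x) \<longlonglongrightarrow> d"
  shows "((\<lambda>s. (f (x + s *\<^sub>R v) - f x) / s) \<longlongrightarrow> d) (at_right 0)"
proof -
  define K where "K = L * norm v"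
  have L0: "0 \<le> L" using lip by (rule lipschitz_on_nonneg)
  define N where "N = (\<lambda>s::real. nat \<lfloor>1 / s\<rfloor>)"
  have N: "filterlim N sequentially (at_right 0)"
    unfolding filterlim_at_top
  proof
    fix k :: nat
    have "k \<le> N s" if "0 < s" "s < 1 / Suc k" for s
    proof -
      have "real k \<le> 1 / s" using that by (simp add: field_simps)
      then have "int k \<le> \<lfloor>1 / s\<rfloor>" by (simp add: le_floor_iff)
      then show ?thesis unfolding N_def by linarith
    qed
    then show "\<forall>\<^sub>F s in at_right 0. k \<le> N s"
      by (auto simp: eventually_at_right_field intro!: exI[of _ "1 / Suc k"])
  qed
  have bound: "\<bar>(f (x + s *\<^sub>R v) - f x) / s - dquot f v (N s) x\<bar> \<le> 2 * K * s" if s: "0 < s" for s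
  proof -
    define t where "t = 1 / real (Suc (N s))"
    have n1: "real (N s) \<le> 1 / s" and n2: "1 / s < real (Suc (N s))"
    proof -
      have "real (N s) = of_int \<lfloor>1 / s\<rfloor>" using s by (simp add: N_def)
      then show "real (N s) \<le> 1 / s" "1 / s < real (Suc (N s))"
        using floor_correct[of "1 / s"] by linarith+
    qed
    have t0: "0 < t" and ts: "t \<le> s"
      using n2 s by (auto simp: t_def field_simps)
    have "1 / t - 1 \<le> 1 / s" using n1 by (simp add: t_def)
    then have st: "s - t \<le> s * t" using s t0 by (simp add: field_simps)
    have lipst: "\<bar>f (x + a *\<^sub>R v) - f (x + b *\<^sub>R v)\<bar> \<le> K * \<bar>a - b\<bar>" for a b
      using lipschitz_onD[OF lip, of "x + a *\<^sub>R v" "x + b *\<^sub>R v"]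
      by (simp add: K_def dist_norm scaleR_diff_left[symmetric] mult.commute mult.left_commute)
    have "\<bar>(f (x + s *\<^sub>R v) - f (x + t *\<^sub>R v)) / s\<bar> \<le> K * (s - t) / s"
      using lipst[of s t] s ts by (simp add: divide_right_mono)
    moreover have "\<bar>(f (x + t *\<^sub>R v) - f x) * (1 / s - 1 / t)\<bar> \<le> K * t * (1 / t - 1 / s)"
      unfolding abs_mult
    proof (rule mult_mono)
      show "\<bar>f (x + t *\<^sub>R v) - f x\<bar> \<le> K * t" using lipst[of t 0] t0 by simp
      show "\<bar>1 / s - 1 / t\<bar> \<le> 1 / t - 1 / s" using s t0 ts by (simp add: frac_le)
    qed (use s t0 L0 K_def in auto)
    moreover have "K * t * (1 / t - 1 / s) = K * (s - t) / s"
      using s t0 by (simp add: field_simps)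
    moreover have "(f (x + s *\<^sub>R v) - f x) / s - dquot f v (N s) x
      = (f (x + s *\<^sub>R v) - f (x + t *\<^sub>R v)) / s + (f (x + t *\<^sub>R v) - f x) * (1 / s - 1 / t)"
      using s t0 by (simp add: dquot_def t_def field_simps)
    ultimately have "\<bar>(f (x + s *\<^sub>R v) - f x) / s - dquot f v (N s) x\<bar> \<le> 2 * (K * (s - t) / s)"
      by linarith
    also have "K * (s - t) / s \<le> K * (s * t) / s"
      using st s L0 by (intro divide_right_mono mult_left_mono) (auto simp: K_def)
    also have "2 * (K * (s * t) / s) \<le> 2 * K * s"
      using s ts L0 mult_left_mono[OF ts, of K] by (simp add: K_def)
    finally show ?thesis by simp
  qed
  have "((\<lambda>s. (f (x + s *\<^sub>R v) - f x) / s - dquot f v (N s) x) \<longlongrightarrow> 0) (at_right 0)"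
  proof (rule Lim_null_comparison)
    show "\<forall>\<^sub>F s in at_right 0. norm ((f (x + s *\<^sub>R v) - f x) / s - dquot f v (N s) x) \<le> 2 * K * s"
      using eventually_at_right_less[of 0] by eventually_elim (use bound in simp)
    show "((\<lambda>s. 2 * K * s) \<longlongrightarrow> 0) (at_right 0)"
      by (rule tendsto_eq_intros tendsto_ident_at refl | simp)+
  qed
  from tendsto_add[OF this filterlim_compose[OF lim N]] show ?thesis by simp
qed

text \<open>The steps \<open>c / Suc n\<close> need not be sampled ones, hence the detour through
  the full limit from the right.\<close>

lemma dquot_tendsto_scaleR:
  fixes f :: "'a::real_normed_vector \<Rightarrow> real"
  assumes lip: "L-lipschitz_on UNIV f" and lim: "(\<lambda>n. dquot f v n x) \<longlonglongrightarrow> d" and "0 < c"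
  shows "(\<lambda>n. dquot f (c *\<^sub>R v) n x) \<longlonglongrightarrow> c * d"
proof -
  have "(\<lambda>n. c * (1 / real (Suc n))) \<longlonglongrightarrow> c * 0"
    by (intro tendsto_mult tendsto_const LIMSEQ_Suc[OF lim_1_over_n])
  then have "filterlim (\<lambda>n. c / real (Suc n)) (at_right 0) sequentially"
    using \<open>0 < c\<close> by (auto simp: filterlim_at)
  from filterlim_compose[OF dquot_tendsto_at_right[OF lip lim] this]
  have "(\<lambda>n. c * ((f (x + (c / real (Suc n)) *\<^sub>R v) - f x) / (c / real (Suc n)))) \<longlonglongrightarrow> c * d"
    by (intro tendsto_mult tendsto_const)
  moreover have "c * ((f (x + (c / real (Suc n)) *\<^sub>R v) - f x) / (c / real (Suc n))) = dquot f (c *\<^sub>R v) n x" for n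
    using \<open>0 < c\<close> by (simp add: dquot_def)
  ultimately show ?thesis by simp
qed

lemma dirderiv_0: "dirderiv f 0 x = 0"
  by (rule dirderiv_eqI) (simp add: dquot_def)

lemma AE_dirderiv_scaleR:
  fixes f :: "'a::euclidean_space \<Rightarrow> real"
  assumes lip: "L-lipschitz_on UNIV f"
  shows "AE x in lborel. dirderiv f (c *\<^sub>R v) x = c * dirderiv f v x"
proof -
  have pos: "AE x in lborel. dirderiv f (c *\<^sub>R v) x = c * dirderiv f v x" if "0 < c" for c
    using AE_dquot_tendsto[OF lip, of v]
    by eventually_elim (rule dirderiv_eqI[OF dquot_tendsto_scaleR[OF lip _ that]])
  consider "c = 0" | "0 < c" | "0 < - c" by linarith
  then show ?thesis
  proof cases
    \<comment> \<open>The vectors \<open>c *\<^sub>R v\<close> and \<open>(- c) *\<^sub>R v\<close>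
      add up to \<open>0\<close>, so additivity reduces a negative factor to the positive one
      \<open>- c\<close>.\<close>
    case 3
    show ?thesis
      using pos[OF 3] AE_dirderiv_add[OF lip, of "c *\<^sub>R v" "(- c) *\<^sub>R v"]
    proof eventually_elim
      case (elim x)
      then show ?case by (simp add: dirderiv_0)
    qed
  qed (use pos in \<open>auto simp: dirderiv_0\<close>)
qed

lemma AE_dirderiv_sum:
  fixes f :: "'a::euclidean_space \<Rightarrow> real"
  assumes lip: "L-lipschitz_on UNIV f" and "finite B"
  shows "AE x in lborel. dirderiv f (\<Sum>b\<in>B. c b *\<^sub>R b) x = (\<Sum>b\<in>B. c b * dirderiv f b x)"
  using \<open>finite B\<close>
proof induction
  case empty
  then show ?case by (simp add: dirderiv_0)
next
  case (insert b B)
  show ?case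
    using insert.IH AE_dirderiv_add[OF lip, of "c b *\<^sub>R b" "\<Sum>b\<in>B. c b *\<^sub>R b"] AE_dirderiv_scaleR[OF lip, of "c b" b]
  proof eventually_elim
    case (elim x)
    then show ?case using insert.hyps by simp
  qed
qed

text \<open>Compactness of the unit sphere makes convergence uniform in the direction: finitely many
  members of \<open>V\<close> come within \<open>\<epsilon>\<close> of every unit vector, and the
  Lipschitz bounds of \<open>f\<close> and \<open>T\<close> bridge the remaining distance.\<close>

lemma has_derivative_if_dense_directions:
  fixes f :: "'a::euclidean_space \<Rightarrow> real"
  assumes lip: "L-lipschitz_on UNIV f" and lin: "bounded_linear T"
    and dense: "\<And>U. open U \<Longrightarrow> U \<noteq> {} \<Longrightarrow> \<exists>v\<in>V. v \<in> U"
    and lim: "\<And>v. v \<in> V \<Longrightarrow> ((\<lambda>s. (f (x + s *\<^sub>R v) - f x) / s) \<longlongrightarrow> T v) (at_right 0)"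
  shows "(f has_derivative T) (at x)"
proof -
  interpret T: bounded_linear T by fact
  obtain K where K: "0 < K" "\<And>h. norm (T h) \<le> norm h * K" using T.pos_bounded by blast
  have L0: "0 \<le> L" using lip by (rule lipschitz_on_nonneg)
  have "\<exists>d>0. \<forall>y. norm (y - x) < d \<longrightarrow> norm (f y - f x - T (y - x)) \<le> e * norm (y - x)" if "0 < e" for e
  proof -
    \<comment> \<open>The limit along a net direction contributes the error
      \<open>\<epsilon>\<close>, passing to that direction contributes \<open>\<epsilon> * L\<close>
      for \<open>f\<close> and \<open>\<epsilon> * K\<close> for \<open>T\<close>.\<close>
    define \<epsilon> where "\<epsilon> = e / (1 + L + K)"
    have \<epsilon>: "0 < \<epsilon>" using that L0 K by (simp add: \<epsilon>_def)
    have "\<exists>W. W \<subseteq> V \<and> finite W \<and> sphere 0 1 \<subseteq> (\<Union>v\<in>W. ball v \<epsilon>)"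
    proof (rule compactE_image[of "sphere 0 1" V "\<lambda>v. ball v \<epsilon>"])
      show "sphere 0 1 \<subseteq> (\<Union>v\<in>V. ball v \<epsilon>)"
      proof
        fix w :: 'a
        obtain v where "v \<in> V" "v \<in> ball w \<epsilon>" using dense[of "ball w \<epsilon>"] \<epsilon> by auto
        then show "w \<in> (\<Union>v\<in>V. ball v \<epsilon>)" by (auto simp: dist_commute)
      qed
    qed auto
    then obtain W where W: "W \<subseteq> V" "finite W" "sphere 0 1 \<subseteq> (\<Union>v\<in>W. ball v \<epsilon>)" by blast
    have "\<forall>\<^sub>F s in at_right 0. \<forall>v\<in>W. \<bar>(f (x + s *\<^sub>R v) - f x) / s - T v\<bar> < \<epsilon>"
      using W(1) tendstoD[OF lim \<epsilon>]
      by (subst eventually_ball_finite_distrib[OF W(2)]) (auto simp: dist_real_def)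
    then obtain d where d: "0 < d" "\<And>s v. 0 < s \<Longrightarrow> s < d \<Longrightarrow> v \<in> W \<Longrightarrow> \<bar>(f (x + s *\<^sub>R v) - f x) / s - T v\<bar> < \<epsilon>"
      by (auto simp: eventually_at_right_field)
    have "norm (f y - f x - T (y - x)) \<le> e * norm (y - x)" if y: "norm (y - x) < d" for y
    proof (cases "y = x")
      case False
      define s w where "s = norm (y - x)" and "w = (y - x) /\<^sub>R s"
      have s: "0 < s" "s < d" using False y by (auto simp: s_def)
      have "w \<in> sphere 0 1" using s(1) by (simp add: w_def s_def)
      then obtain v where v: "v \<in> W" "norm (w - v) < \<epsilon>" using W(3) by (auto simp: dist_norm norm_minus_commute)
      have y_eq: "y = x + s *\<^sub>R w" using s by (simp add: w_def)
      have "\<bar>f y - f (x + s *\<^sub>R v)\<bar> \<le> L * norm (s *\<^sub>R (w - v))"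
        using lipschitz_onD[OF lip, of y "x + s *\<^sub>R v"] unfolding y_eq
        by (simp add: dist_norm scaleR_diff_right)
      also have "\<dots> \<le> L * (s * \<epsilon>)"
        using v s L0 by (auto intro!: mult_left_mono)
      finally have 1: "\<bar>f y - f (x + s *\<^sub>R v)\<bar> \<le> s * (\<epsilon> * L)" by (simp add: algebra_simps)
      have "\<bar>f (x + s *\<^sub>R v) - f x - s * T v\<bar> = s * \<bar>(f (x + s *\<^sub>R v) - f x) / s - T v\<bar>"
        using s by (simp add: abs_mult_pos'[symmetric] field_simps)
      also have "\<dots> \<le> s * \<epsilon>" using d(2)[OF s v(1)] s by (intro mult_left_mono) auto
      finally have 2: "\<bar>f (x + s *\<^sub>R v) - f x - s * T v\<bar> \<le> s * \<epsilon>" .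
      have "\<bar>T (s *\<^sub>R (v - w))\<bar> \<le> norm (s *\<^sub>R (v - w)) * K" using K(2)[of "s *\<^sub>R (v - w)"] by simp
      also have "\<dots> \<le> s * \<epsilon> * K"
        using v s K(1) by (auto intro!: mult_right_mono mult_left_mono simp: norm_minus_commute)
      finally have 3: "\<bar>s * T v - T (y - x)\<bar> \<le> s * (\<epsilon> * K)"
        by (simp add: y_eq T.scaleR T.diff algebra_simps)
      have "\<bar>f y - f x - T (y - x)\<bar> \<le> s * (\<epsilon> * L) + s * \<epsilon> + s * (\<epsilon> * K)"
        using 1 2 3 by linarith
      also have "\<dots> = s * (\<epsilon> * (1 + L + K))" by (simp add: algebra_simps)
      also have "\<epsilon> * (1 + L + K) = e" using L0 K by (simp add: \<epsilon>_def)
      finally show ?thesis by (simp add: s_def mult.commute)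
    qed (simp add: T.zero)
    with d(1) show ?thesis by blast
  qed
  then show ?thesis using lin by (simp add: has_derivative_at_alt)
qed

text \<open>Countability of the dense set \<open>V\<close> keeps the exceptional set null, both for
  the existence of the limits and for their linearity, which is imposed only on the basis expansions
  of members of \<open>V\<close>.\<close>

theorem Rademacher_real:
  fixes f :: "'a::euclidean_space \<Rightarrow> real"
  assumes lip: "L-lipschitz_on UNIV f"
  shows "AE x in lborel. f differentiable (at x)"
proof -
  obtain V :: "'a set" where V: "countable V" "\<And>U. open U \<Longrightarrow> U \<noteq> {} \<Longrightarrow> \<exists>v\<in>V. v \<in> U"
    by (erule countable_dense_setE)
  have "AE x in lborel. \<forall>v\<in>V. (\<lambda>n. dquot f v n x) \<longlonglongrightarrow> dirderiv f v x"
    using V(1) AE_dquot_tendsto[OF lip] by (simp add: AE_ball_countable)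
  moreover have "AE x in lborel. \<forall>v\<in>V. dirderiv f (\<Sum>b\<in>Basis. (v \<bullet> b) *\<^sub>R b) x = (\<Sum>b\<in>Basis. (v \<bullet> b) * dirderiv f b x)"
    using V(1) AE_dirderiv_sum[OF lip finite_Basis] by (simp only: AE_ball_countable) blast
  ultimately show ?thesis
  proof eventually_elim
    case (elim x)
    have "(f has_derivative (\<lambda>h. \<Sum>b\<in>Basis. (h \<bullet> b) * dirderiv f b x)) (at x)"
    proof (rule has_derivative_if_dense_directions[OF lip _ V(2)])
      show "bounded_linear (\<lambda>h. \<Sum>b\<in>Basis. (h \<bullet> b) * dirderiv f b x)"
        by (intro bounded_linear_sum bounded_linear_mult_const bounded_linear_inner_left)
      fix v assume "v \<in> V"
      then have "(\<lambda>n. dquot f v n x) \<longlonglongrightarrow> (\<Sum>b\<in>Basis. (v \<bullet> b) * dirderiv f b x)"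
        using elim by (simp add: euclidean_representation)
      then show "((\<lambda>s. (f (x + s *\<^sub>R v) - f x) / s) \<longlongrightarrow> (\<Sum>b\<in>Basis. (v \<bullet> b) * dirderiv f b x)) (at_right 0)"
        by (rule dquot_tendsto_at_right[OF lip])
    qed
    then show ?case by (rule differentiableI)
  qed
qed

theorem Rademacher:
  fixes f :: "'a::euclidean_space \<Rightarrow> 'b::euclidean_space"
  assumes lip: "L-lipschitz_on UNIV f"
  shows "AE x in lborel. f differentiable (at x)"
proof -
  have "AE x in lborel. (\<lambda>x. f x \<bullet> i) differentiable (at x)" if "i \<in> Basis" for i
  proof (rule Rademacher_real)
    show "L-lipschitz_on UNIV (\<lambda>x. f x \<bullet> i)"
    proof (rule lipschitz_onI)
      fix x y
      have "dist (f x \<bullet> i) (f y \<bullet> i) \<le> dist (f x) (f y)"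
        using Basis_le_norm[OF that, of "f x - f y"] by (simp add: dist_norm inner_diff_left)
      also have "\<dots> \<le> L * dist x y" by (rule lipschitz_onD[OF lip]) auto
      finally show "dist (f x \<bullet> i) (f y \<bullet> i) \<le> L * dist x y" .
    qed (rule lipschitz_on_nonneg[OF lip])
  qed
  then have "AE x in lborel. \<forall>i\<in>Basis. (\<lambda>x. f x \<bullet> i) differentiable (at x)"
    by (intro AE_finite_allI finite_Basis)
  then show ?thesis
    by eventually_elim (subst differentiable_componentwise_within, blast)
qed

section \<open>Almost everywhere bounds on difference quotients\<close>

text \<open>No differentiability is needed: integrating a telescoping sum of difference quotients over a
  small ball of base points, dominated convergence turns the a.e. bound into a bound on every segment.\<close>

lemma lipschitz_increment_le_if_AE_quotient_le:
  fixes f :: "'a::euclidean_space \<Rightarrow> real"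
  assumes lip: "M-lipschitz_on UNIV f" and U: "open U" "bounded U"
    and seg: "closed_segment x (x + t *\<^sub>R v) \<subseteq> U" and "0 < t"
    and ae: "AE y in lborel. y \<in> U \<longrightarrow> (\<forall>e>0. \<forall>\<^sub>F d in at_right 0. f (y + d *\<^sub>R v) - f y \<le> (c + e) * d)"
  shows "f (x + t *\<^sub>R v) - f x \<le> c * t"
proof -
  have M0: "0 \<le> M" using lip by (rule lipschitz_on_nonneg)
  have [measurable]: "f \<in> borel_measurable borel" "U \<in> sets borel"
    using lipschitz_on_continuous_on[OF lip] U by (auto intro: borel_measurable_continuous_onI)
  define \<delta> where "\<delta> = (\<lambda>n. t / real (Suc n))"
  have \<delta>0: "0 < \<delta> n" for n using \<open>0 < t\<close> by (simp add: \<delta>_def)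
  define E where "E = (\<lambda>n y. (f (y + \<delta> n *\<^sub>R v) - f y) / \<delta> n)"
  \<comment> \<open>The excess of the quotient over \<open>c\<close>, cut off below at
    \<open>0\<close> and outside \<open>U\<close>: uniformly bounded, and tending to
    \<open>0\<close> almost everywhere.\<close>
  define P where "P = (\<lambda>n y. indicator U y * max 0 (E n y - c))"
  have [measurable]: "P n \<in> borel_measurable borel" for n
    unfolding P_def E_def by measurable
  have E_bound: "\<bar>E n y\<bar> \<le> M * norm v" for n y
    using lipschitz_onD[OF lip, of "y + \<delta> n *\<^sub>R v" y] \<delta>0[of n]
    by (simp add: E_def dist_norm divide_le_eq mult.commute mult.left_commute)
  have P_nonneg: "0 \<le> P n y" for n y by (simp add: P_def)
  have P_bound: "norm (P n y) \<le> indicator U y * (M * norm v + \<bar>c\<bar>)" for n y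
    using E_bound[of n y] by (auto simp: P_def indicator_def)
  have dom: "integrable lborel (\<lambda>y. indicator U y * (M * norm v + \<bar>c\<bar>))"
    using U by (intro integrable_mult_left integrable_real_indicator emeasure_bounded_finite) auto
  have P_int: "integrable lborel (P n)" for n
    by (rule Bochner_Integration.integrable_bound[OF dom])
       (auto intro!: AE_I2 order_trans[OF P_bound] abs_ge_self simp del: real_norm_def simp: real_norm_def[of "_ * _"])
  have "(\<lambda>n. \<integral>y. P n y \<partial>lborel) \<longlonglongrightarrow> (\<integral>y. 0 \<partial>(lborel :: 'a measure))"
  proof (rule integral_dominated_convergence[OF _ _ dom])
    show "AE y in lborel. (\<lambda>n. P n y) \<longlonglongrightarrow> 0"
      using ae
    proof eventually_elim
      case (elim y)
      show ?case
      proof (cases "y \<in> U")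
        case True
        have lim: "filterlim \<delta> (at_right 0) sequentially"
        proof -
          have "(\<lambda>n. t * (1 / real (Suc n))) \<longlonglongrightarrow> t * 0"
            by (intro tendsto_mult tendsto_const LIMSEQ_Suc[OF lim_1_over_n])
          then show ?thesis using \<open>0 < t\<close> by (auto simp: filterlim_at \<delta>_def[abs_def])
        qed
        show ?thesis
        proof (rule tendstoI)
          fix e :: real assume "0 < e"
          then have "\<forall>\<^sub>F d in at_right 0. f (y + d *\<^sub>R v) - f y \<le> (c + e / 2) * d"
            using elim True by simp
          then have "\<forall>\<^sub>F n in sequentially. f (y + \<delta> n *\<^sub>R v) - f y \<le> (c + e / 2) * \<delta> n"
            using lim by (auto simp: filterlim_iff)
          then show "\<forall>\<^sub>F n in sequentially. dist (P n y) 0 < e"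
          proof eventually_elim
            case (elim n)
            then have "E n y \<le> c + e / 2" using \<delta>0[of n] by (simp add: E_def divide_le_eq)
            then show ?case using \<open>0 < e\<close> True by (auto simp: P_def dist_real_def)
          qed
        qed
      qed (simp add: P_def)
    qed
  qed (use P_bound in auto)
  then have P_lim: "(\<lambda>n. \<integral>y. P n y \<partial>lborel) \<longlonglongrightarrow> 0" by simp
  obtain r0 where r0: "0 < r0" "\<And>z. z \<in> closed_segment x (x + t *\<^sub>R v) \<Longrightarrow> ball z r0 \<subseteq> U"
    using compact_subset_open_imp_ball_epsilon_subset[OF compact_segment U(1) seg]
    by (metis UN_subset_iff)
  \<comment> \<open>The radius \<open>r\<close> stays fixed while \<open>n\<close> tends to
    infinity; \<open>2 * M * r\<close> pays for translating both endpoints by a vector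
    \<open>z\<close> of the ball.\<close>
  have main: "f (x + t *\<^sub>R v) - f x - 2 * M * r \<le> c * t" if r: "0 < r" "r \<le> r0" for r
  proof -
    let ?B = "ball (0::'a) r"
    let ?a = "f (x + t *\<^sub>R v) - f x - 2 * M * r"
    have pt: "?a \<le> c * t + (\<Sum>i\<le>n. \<delta> n * P n ((x + (real i * \<delta> n) *\<^sub>R v) + z))" if z: "z \<in> ?B" for n z
    proof -
      let ?p = "\<lambda>i. (x + (real i * \<delta> n) *\<^sub>R v) + z"
      have pU: "?p i \<in> U" if "i \<le> n" for i
      proof -
        have "x + (real i * \<delta> n) *\<^sub>R v \<in> closed_segment x (x + t *\<^sub>R v)"
          unfolding in_segment using that
          by (intro exI[of _ "real i / real (Suc n)"]) (auto simp: \<delta>_def algebra_simps)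
        from r0(2)[OF this] z r show ?thesis by (auto simp: subset_iff dist_norm)
      qed
      have "f (?p (Suc i)) - f (?p i) \<le> \<delta> n * (c + P n (?p i))" if "i \<le> n" for i
      proof -
        have p: "?p (Suc i) = ?p i + \<delta> n *\<^sub>R v" by (simp add: algebra_simps)
        have "f (?p (Suc i)) - f (?p i) = \<delta> n * E n (?p i)"
          unfolding p E_def using \<delta>0[of n] by simp
        also have "\<dots> \<le> \<delta> n * (c + P n (?p i))"
          using \<delta>0[of n] pU[OF that] by (intro mult_left_mono) (auto simp: P_def)
        finally show ?thesis .
      qed
      then have "(\<Sum>i\<le>n. f (?p (Suc i)) - f (?p i)) \<le> (\<Sum>i\<le>n. \<delta> n * (c + P n (?p i)))"
        by (intro sum_mono) auto
      moreover have "(\<Sum>i\<le>n. f (?p (Suc i)) - f (?p i)) = f (?p (Suc n)) - f (?p 0)"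
        using sum_lessThan_telescope[of "\<lambda>i. f (?p i)" "Suc n"]
        by (simp only: lessThan_Suc_atMost)
      moreover have "?p (Suc n) = x + t *\<^sub>R v + z" "?p 0 = x + z"
        by (simp_all add: \<delta>_def)
      moreover have "(\<Sum>i\<le>n. \<delta> n * (c + P n (?p i))) = c * t + (\<Sum>i\<le>n. \<delta> n * P n (?p i))"
        by (simp add: distrib_left sum.distrib \<delta>_def)
      ultimately have "f (x + t *\<^sub>R v + z) - f (x + z) \<le> c * t + (\<Sum>i\<le>n. \<delta> n * P n (?p i))"
        by metis
      moreover have "\<bar>f (x + t *\<^sub>R v) - f (x + t *\<^sub>R v + z)\<bar> \<le> M * r" "\<bar>f (x + z) - f x\<bar> \<le> M * r"
        using lipschitz_onD[OF lip, of "x + t *\<^sub>R v" "x + t *\<^sub>R v + z"] lipschitz_onD[OF lip, of "x + z" x] z M0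
          mult_left_mono[of "norm z" r M]
        by (auto simp: dist_norm)
      ultimately show ?thesis by linarith
    qed
    \<comment> \<open>By translation invariance each of the \<open>Suc n\<close> terms of the sum
      contributes the same integral, and \<open>Suc n\<close> times \<open>\<delta> n\<close> is
      \<open>t\<close>, so the error stays bounded by \<open>t\<close> times a null
      sequence.\<close>
    have trans: "integrable lborel (\<lambda>z. P n (p + z))" "(\<integral>z. P n (p + z) \<partial>lborel) = (\<integral>y. P n y \<partial>lborel)" for n p
    proof -
      have "integrable (distr lborel borel ((+) p)) (P n)" using P_int[of n] by (simp add: lborel_distr_plus)
      then show "integrable lborel (\<lambda>z. P n (p + z))"
        by (subst (asm) integrable_distr_eq) auto
      have "(\<integral>y. P n y \<partial>distr lborel borel ((+) p)) = (\<integral>z. P n (p + z) \<partial>lborel)"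
        by (subst integral_distr) auto
      then show "(\<integral>z. P n (p + z) \<partial>lborel) = (\<integral>y. P n y \<partial>lborel)" by (simp add: lborel_distr_plus)
    qed
    have iB: "integrable lborel (\<lambda>z. indicator ?B z * k)" for k :: real
      by (intro integrable_mult_left integrable_real_indicator emeasure_bounded_finite) auto
    have iS: "integrable lborel (\<lambda>z. \<Sum>i\<le>n. \<delta> n * P n ((x + (real i * \<delta> n) *\<^sub>R v) + z))" for n
      by (intro Bochner_Integration.integrable_sum integrable_mult_right trans(1))
    have "measure lborel ?B * ?a \<le> measure lborel ?B * (c * t) + t * (\<integral>y. P n y \<partial>lborel)" for n
    proof -
      have "(\<integral>z. indicator ?B z * ?a \<partial>lborel)
          \<le> (\<integral>z. indicator ?B z * (c * t) + (\<Sum>i\<le>n. \<delta> n * P n ((x + (real i * \<delta> n) *\<^sub>R v) + z)) \<partial>lborel)"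
      proof (rule integral_mono[OF iB Bochner_Integration.integrable_add[OF iB iS]])
        fix z
        have "0 \<le> (\<Sum>i\<le>n. \<delta> n * P n ((x + (real i * \<delta> n) *\<^sub>R v) + z))"
          using \<delta>0[of n] P_nonneg by (intro sum_nonneg mult_nonneg_nonneg) (auto intro: less_imp_le)
        then show "indicator ?B z * ?a \<le> indicator ?B z * (c * t) + (\<Sum>i\<le>n. \<delta> n * P n ((x + (real i * \<delta> n) *\<^sub>R v) + z))"
          using pt[of z n] by (cases "z \<in> ?B") auto
      qed
      also have "\<dots> = (\<integral>z. indicator ?B z * (c * t) \<partial>lborel) + (\<integral>z. (\<Sum>i\<le>n. \<delta> n * P n ((x + (real i * \<delta> n) *\<^sub>R v) + z)) \<partial>lborel)"
        by (rule Bochner_Integration.integral_add[OF iB iS])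
      also have "(\<integral>z. (\<Sum>i\<le>n. \<delta> n * P n ((x + (real i * \<delta> n) *\<^sub>R v) + z)) \<partial>lborel) = (\<Sum>i\<le>n. \<delta> n * (\<integral>y. P n y \<partial>lborel))"
        by (subst Bochner_Integration.integral_sum) (auto intro!: integrable_mult_right trans(1) simp: trans(2))
      also have "\<dots> = t * (\<integral>y. P n y \<partial>lborel)" by (simp add: \<delta>_def)
      finally show ?thesis by simp
    qed
    moreover have "(\<lambda>n. measure lborel ?B * (c * t) + t * (\<integral>y. P n y \<partial>lborel)) \<longlonglongrightarrow> measure lborel ?B * (c * t) + t * 0"
      by (intro tendsto_add tendsto_mult tendsto_const P_lim)
    ultimately have "measure lborel ?B * ?a \<le> measure lborel ?B * (c * t) + t * 0"
      by (intro LIMSEQ_le_const) auto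
    moreover have "0 < measure lborel ?B" using content_ball_pos[OF r(1), of "0::'a"] by simp
    ultimately show ?thesis by simp
  qed
  show ?thesis
  proof (rule field_le_epsilon)
    fix e :: real assume "0 < e"
    define r where "r = min r0 (e / (2 * M + 1))"
    have "0 < r" "r \<le> r0" using r0 \<open>0 < e\<close> M0 by (auto simp: r_def)
    moreover have "2 * M * r \<le> e"
    proof -
      have "2 * M * r \<le> (2 * M + 1) * r" using \<open>0 < r\<close> by (simp add: distrib_right)
      also have "\<dots> \<le> (2 * M + 1) * (e / (2 * M + 1))"
        using M0 by (intro mult_left_mono) (auto simp: r_def)
      finally show ?thesis using M0 by simp
    qed
    ultimately show "f (x + t *\<^sub>R v) - f x \<le> c * t + e" using main[of r] by linarith
  qed
qed

text \<open>On a piece with \<open>K * (b - a) \<le> 1 / 2\<close> that starts at a zero, the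
  maximum \<open>\<phi> p\<close> is at most \<open>K * \<phi> p * (p - a)\<close>, thus at most
  half of itself, and vanishes. Finitely many such pieces reach \<open>T\<close>.\<close>

lemma gronwall_AE_eq_0:
  fixes \<phi> :: "real \<Rightarrow> real"
  assumes lip: "M-lipschitz_on {0..T} \<phi>" and "0 \<le> T" "0 \<le> K"
    and nonneg: "\<And>s. s \<in> {0..T} \<Longrightarrow> 0 \<le> \<phi> s" and "\<phi> 0 = 0"
    and ae: "AE s in lborel. s \<in> {0<..<T} \<longrightarrow> (\<forall>e>0. \<forall>\<^sub>F d in at_right 0. \<phi> (s + d) - \<phi> s \<le> (K * \<phi> s + e) * d)"
  shows "\<phi> T = 0"
proof -
  have M0: "0 \<le> M" using lip by (rule lipschitz_on_nonneg)
  have step: "\<phi> b = 0" if ab: "0 \<le> a" "a < b" "b \<le> T" "K * (b - a) \<le> 1 / 2" "\<phi> a = 0" for a b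
  proof -
    \<comment> \<open>Constant continuation beyond \<open>a\<close> and \<open>b\<close> produces a
      function that is Lipschitz on the whole line, as the increment lemma requires. The two corner
      points are a null set and may be skipped.\<close>
    define clamp where "clamp = (\<lambda>s. max a (min b s))"
    have clamp_in: "clamp s \<in> {a..b}" for s using ab by (auto simp: clamp_def)
    have clamp_id: "clamp s = s" if "s \<in> {a..b}" for s using that by (auto simp: clamp_def)
    have "continuous_on {a..b} \<phi>"
      using lipschitz_on_continuous_on[OF lip] ab by (auto elim: continuous_on_subset)
    then obtain p where p: "p \<in> {a..b}" "\<And>s. s \<in> {a..b} \<Longrightarrow> \<phi> s \<le> \<phi> p"
      using continuous_attains_sup[of "{a..b}" \<phi>] ab by auto
    have p0: "0 \<le> \<phi> p" using nonneg[of p] p(1) ab by auto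
    define \<psi> where "\<psi> = (\<lambda>s. \<phi> (clamp s))"
    have lip\<psi>: "M-lipschitz_on UNIV \<psi>"
    proof (rule lipschitz_onI)
      fix s t
      have "dist (\<psi> s) (\<psi> t) \<le> M * dist (clamp s) (clamp t)"
        unfolding \<psi>_def using clamp_in[of s] clamp_in[of t] ab by (intro lipschitz_onD[OF lip]) auto
      also have "\<dots> \<le> M * dist s t"
        using M0 ab by (intro mult_left_mono) (auto simp: clamp_def dist_real_def min_def max_def)
      finally show "dist (\<psi> s) (\<psi> t) \<le> M * dist s t" .
    qed (rule M0)
    have ae\<psi>: "AE y in lborel. y \<in> {a-1<..<b+1} \<longrightarrow>
        (\<forall>e>0. \<forall>\<^sub>F d in at_right 0. \<psi> (y + d *\<^sub>R 1) - \<psi> y \<le> (K * \<phi> p + e) * d)"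
      using ae AE_lborel_singleton[of a] AE_lborel_singleton[of b]
    proof eventually_elim
      case (elim y)
      show ?case
      proof (intro impI allI)
        fix e :: real assume "0 < e"
        consider "y < a" | "a < y" "y < b" | "b < y" using elim by linarith
        then show "\<forall>\<^sub>F d in at_right 0. \<psi> (y + d *\<^sub>R 1) - \<psi> y \<le> (K * \<phi> p + e) * d"
        proof cases
          case 1
          have "\<psi> (y + d *\<^sub>R 1) - \<psi> y \<le> (K * \<phi> p + e) * d" if "0 < d" "d < a - y" for d
            using that 1 ab p0 \<open>0 < e\<close> \<open>0 \<le> K\<close> by (auto simp: \<psi>_def clamp_def)
          then show ?thesis using 1 by (auto simp: eventually_at_right_field intro!: exI[of _ "a - y"])
        next
          case 2
          have "\<forall>\<^sub>F d in at_right 0. \<phi> (y + d) - \<phi> y \<le> (K * \<phi> y + e) * d"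
            using elim 2 ab \<open>0 < e\<close> by auto
          moreover have "\<forall>\<^sub>F d in at_right 0. 0 < d \<and> d < b - y"
            using 2 by (auto simp: eventually_at_right_field intro!: exI[of _ "b - y"])
          ultimately show ?thesis
          proof eventually_elim
            case (elim d)
            have "K * \<phi> y \<le> K * \<phi> p" using p(2)[of y] 2 \<open>0 \<le> K\<close> by (intro mult_left_mono) auto
            then have "(K * \<phi> y + e) * d \<le> (K * \<phi> p + e) * d" using elim by (intro mult_right_mono) auto
            moreover have "\<psi> (y + d *\<^sub>R 1) = \<phi> (y + d)" "\<psi> y = \<phi> y"
              using elim 2 by (simp_all add: \<psi>_def clamp_id)
            ultimately show ?case using elim by linarith
          qed
        next
          case 3
          have "\<psi> (y + d *\<^sub>R 1) - \<psi> y \<le> (K * \<phi> p + e) * d" if "0 < d" for d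
            using that 3 ab p0 \<open>0 < e\<close> \<open>0 \<le> K\<close> by (auto simp: \<psi>_def clamp_def)
          then show ?thesis by (auto simp: eventually_at_right_field intro!: exI[of _ 1])
        qed
      qed
    qed
    have incr: "\<phi> y \<le> K * \<phi> p * (y - a)" if "y \<in> {a..b}" for y
    proof (cases "y = a")
      case False
      have "\<psi> (a + (y - a) *\<^sub>R 1) - \<psi> a \<le> K * \<phi> p * (y - a)"
        using that False
        by (intro lipschitz_increment_le_if_AE_quotient_le[OF lip\<psi> _ _ _ _ ae\<psi>])
           (auto simp: closed_segment_eq_real_ivl)
      then show ?thesis using that ab by (simp add: \<psi>_def clamp_id)
    qed (use ab in auto)
    have "K * (p - a) \<le> K * (b - a)" using p(1) \<open>0 \<le> K\<close> by (intro mult_left_mono) auto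
    then have "K * (p - a) \<le> 1 / 2" using ab(4) by linarith
    then have "\<phi> p * (K * (p - a)) \<le> \<phi> p * (1 / 2)" using p0 by (intro mult_left_mono)
    then have "\<phi> p \<le> 0" using incr[OF p(1)] by (simp add: algebra_simps)
    then show ?thesis using p(2)[of b] nonneg[of b] ab by auto
  qed
  obtain n :: nat where n: "2 * (K * T) < real n" using reals_Archimedean2 by blast
  define h where "h = T / real (Suc n)"
  have hK: "K * h \<le> 1 / 2"
    using n by (simp add: h_def field_simps)
  show ?thesis
  proof (cases "T = 0")
    case False
    then have h0: "0 < h" using \<open>0 \<le> T\<close> by (simp add: h_def)
    have "\<phi> (real i * h) = 0" if "i \<le> Suc n" for i
      using that
    proof (induction i)
      case (Suc i)
      have "real (Suc i) * h \<le> T"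
      proof -
        have "real (Suc i) * h \<le> real (Suc n) * h" using Suc.prems h0 by (intro mult_right_mono) auto
        then show ?thesis by (simp add: h_def)
      qed
      then show ?case
        using Suc h0 hK by (intro step[of "real i * h" "real (Suc i) * h"]) (auto simp: algebra_simps)
    qed (use \<open>\<phi> 0 = 0\<close> in simp)
    from this[of "Suc n"] show ?thesis by (simp add: h_def)
  qed (use \<open>\<phi> 0 = 0\<close> in simp)
qed

section \<open>Distance to the tuples of small rank\<close>

text \<open>Among the equivalent norms on \<open>q\<close>-tuples the sum of norms suits termwise
  estimates. For \<open>0 < p\<close> the zero tuple is a competitor, so the infimum is taken over a
  nonempty set.\<close>

definition rdist :: "nat \<Rightarrow> nat \<Rightarrow> (nat \<Rightarrow> 'a::euclidean_space) \<Rightarrow> real" where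
  "rdist p q a = (INF r\<in>{r. dim (r ` {..<q}) < p}. \<Sum>k<q. norm (a k - r k))"

lemma rdist_le:
  assumes "dim (r ` {..<q}) < p" shows "rdist p q a \<le> (\<Sum>k<q. norm (a k - r k))"
  unfolding rdist_def
  by (rule cINF_lower) (use assms in \<open>auto intro!: bdd_belowI2[of _ 0] sum_nonneg\<close>)

lemma rdist_greatest:
  fixes a :: "nat \<Rightarrow> 'a::euclidean_space"
  assumes "0 < p" and "\<And>r. dim (r ` {..<q}) < p \<Longrightarrow> m \<le> (\<Sum>k<q. norm (a k - r k))"
  shows "m \<le> rdist p q a"
  unfolding rdist_def
proof (rule cINF_greatest)
  have "dim ((\<lambda>_. 0 :: 'a) ` {..<q}) = 0" by (auto simp: dim_eq_0)
  then have "(\<lambda>_. 0) \<in> {r :: nat \<Rightarrow> 'a. dim (r ` {..<q}) < p}"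
    using \<open>0 < p\<close> unfolding mem_Collect_eq by linarith
  then show "{r :: nat \<Rightarrow> 'a. dim (r ` {..<q}) < p} \<noteq> {}" by blast
qed (use assms in auto)

lemma rdist_nonneg: "0 < p \<Longrightarrow> 0 \<le> rdist p q a"
  by (rule rdist_greatest) (auto intro: sum_nonneg)

lemma rdist_triangle:
  assumes "0 < p" shows "rdist p q a \<le> rdist p q b + (\<Sum>k<q. norm (a k - b k))"
proof -
  have "rdist p q a - (\<Sum>k<q. norm (a k - b k)) \<le> rdist p q b"
  proof (rule rdist_greatest[OF assms])
    fix r :: "nat \<Rightarrow> 'a" assume "dim (r ` {..<q}) < p"
    then have "rdist p q a \<le> (\<Sum>k<q. norm (a k - r k))" by (rule rdist_le)
    also have "\<dots> \<le> (\<Sum>k<q. norm (a k - b k) + norm (b k - r k))"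
    proof (rule sum_mono)
      fix k show "norm (a k - r k) \<le> norm (a k - b k) + norm (b k - r k)"
        using norm_triangle_ineq[of "a k - b k" "b k - r k"] by simp
    qed
    finally show "rdist p q a - (\<Sum>k<q. norm (a k - b k)) \<le> (\<Sum>k<q. norm (b k - r k))"
      by (simp add: sum.distrib)
  qed
  then show ?thesis by simp
qed

text \<open>Since \<open>\<Phi>\<close> does not raise the rank, it sends every competitor
  \<open>r\<close> for \<open>a\<close> to a competitor for \<open>\<Phi> a\<close>; the factor
  \<open>\<kappa>\<close> then passes to the infimum.\<close>

lemma rdist_transform_le:
  assumes "0 < p" "0 < \<kappa>" and dim: "\<And>r. dim (\<Phi> r ` {..<q}) \<le> dim (r ` {..<q})"
    and dist: "\<And>r. (\<Sum>k<q. norm (\<Phi> a k - \<Phi> r k)) \<le> \<kappa> * (\<Sum>k<q. norm (a k - r k))"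
  shows "rdist p q (\<Phi> a) \<le> \<kappa> * rdist p q a"
proof -
  have "rdist p q (\<Phi> a) / \<kappa> \<le> rdist p q a"
  proof (rule rdist_greatest[OF \<open>0 < p\<close>])
    fix r :: "nat \<Rightarrow> 'a" assume "dim (r ` {..<q}) < p"
    then have "rdist p q (\<Phi> a) \<le> (\<Sum>k<q. norm (\<Phi> a k - \<Phi> r k))"
      by (intro rdist_le le_less_trans[OF dim])
    also note dist
    finally show "rdist p q (\<Phi> a) / \<kappa> \<le> (\<Sum>k<q. norm (a k - r k))"
      using \<open>0 < \<kappa>\<close> by (simp add: divide_le_eq mult.commute)
  qed
  then show ?thesis using \<open>0 < \<kappa>\<close> by (simp add: divide_le_eq mult.commute)
qed

text \<open>The mixing of entries by \<open>c\<close> and the map \<open>1 + s B\<close> are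
  composed rather than added: a composition visibly does not raise the rank, whereas its first-order
  expansion might. The price is a cross term of order \<open>s * s\<close>. The factor
  \<open>q * \<gamma>\<close> arises because each of the \<open>q\<close> entries moves by up to
  \<open>s * \<gamma>\<close> times the whole distance.\<close>

lemma rdist_infinitesimal_transform_le:
  fixes a :: "nat \<Rightarrow> 'a::euclidean_space" and c :: "nat \<Rightarrow> nat \<Rightarrow> real"
  assumes "0 < p" "linear B" and B: "\<And>x. norm (B x) \<le> \<beta> * norm x" and "0 \<le> \<beta>"
    and c: "\<And>k l. k < q \<Longrightarrow> l < q \<Longrightarrow> \<bar>c k l\<bar> \<le> \<gamma>" and "0 \<le> \<gamma>" "0 \<le> s"
  shows "rdist p q (\<lambda>k. (a k + s *\<^sub>R (\<Sum>l<q. c k l *\<^sub>R a l)) + s *\<^sub>R B (a k + s *\<^sub>R (\<Sum>l<q. c k l *\<^sub>R a l)))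
    \<le> (1 + s * \<beta>) * (1 + s * (q * \<gamma>)) * rdist p q a"
proof -
  define \<Psi> :: "(nat \<Rightarrow> 'a) \<Rightarrow> nat \<Rightarrow> 'a" where "\<Psi> = (\<lambda>r k. r k + s *\<^sub>R (\<Sum>l<q. c k l *\<^sub>R r l))"
  define X where "X = (\<lambda>w. w + s *\<^sub>R B w)"
  have linX: "linear X"
    unfolding X_def using \<open>linear B\<close>
    by (intro linear_compose_add linear_id[unfolded id_def] linear_compose_scale_right)
  have "rdist p q ((\<lambda>r k. X (\<Psi> r k)) a) \<le> (1 + s * \<beta>) * (1 + s * (q * \<gamma>)) * rdist p q a"
  proof (rule rdist_transform_le[OF \<open>0 < p\<close>])
    show "0 < (1 + s * \<beta>) * (1 + s * (q * \<gamma>))"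
      using assms by (intro mult_pos_pos add_pos_nonneg mult_nonneg_nonneg) auto
    fix r :: "nat \<Rightarrow> 'a"
    have "\<Psi> r k \<in> span (r ` {..<q})" if "k < q" for k
      unfolding \<Psi>_def using that
      by (intro span_add span_scale span_sum span_base) auto
    then have "(\<lambda>k. X (\<Psi> r k)) ` {..<q} \<subseteq> X ` span (r ` {..<q})" by auto
    then have "dim ((\<lambda>k. X (\<Psi> r k)) ` {..<q}) \<le> dim (X ` span (r ` {..<q}))" by (rule dim_subset)
    also have "\<dots> \<le> dim (span (r ` {..<q}))" by (rule dim_image_le[OF linX])
    finally show "dim ((\<lambda>k. X (\<Psi> r k)) ` {..<q}) \<le> dim (r ` {..<q})" by simp
    let ?D = "\<Sum>l<q. norm (a l - r l)"
    have X: "norm (X w) \<le> (1 + s * \<beta>) * norm w" for w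
    proof -
      have "norm (X w) \<le> norm w + s * norm (B w)"
        unfolding X_def using norm_triangle_ineq[of w "s *\<^sub>R B w"] \<open>0 \<le> s\<close> by simp
      also have "\<dots> \<le> norm w + s * (\<beta> * norm w)" using B \<open>0 \<le> s\<close> by (intro add_mono mult_left_mono) auto
      finally show ?thesis by (simp add: algebra_simps)
    qed
    have \<Psi>: "norm (\<Psi> a k - \<Psi> r k) \<le> norm (a k - r k) + s * (\<gamma> * ?D)" if "k < q" for k
    proof -
      have "\<Psi> a k - \<Psi> r k = (a k - r k) + s *\<^sub>R (\<Sum>l<q. c k l *\<^sub>R (a l - r l))"
        by (simp add: \<Psi>_def scaleR_diff_right sum_subtractf)
      then have "norm (\<Psi> a k - \<Psi> r k) \<le> norm (a k - r k) + s * norm (\<Sum>l<q. c k l *\<^sub>R (a l - r l))"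
        using norm_triangle_ineq[of "a k - r k" "s *\<^sub>R (\<Sum>l<q. c k l *\<^sub>R (a l - r l))"] \<open>0 \<le> s\<close> by simp
      also have "norm (\<Sum>l<q. c k l *\<^sub>R (a l - r l)) \<le> (\<Sum>l<q. \<gamma> * norm (a l - r l))"
        using c[OF that] by (intro sum_norm_le) (auto intro: mult_right_mono)
      finally show ?thesis using \<open>0 \<le> s\<close> by (simp add: sum_distrib_left mult_left_mono)
    qed
    have "(\<Sum>k<q. norm (X (\<Psi> a k) - X (\<Psi> r k))) \<le> (\<Sum>k<q. (1 + s * \<beta>) * (norm (a k - r k) + s * (\<gamma> * ?D)))"
    proof (rule sum_mono)
      fix k assume "k \<in> {..<q}"
      have "norm (X (\<Psi> a k) - X (\<Psi> r k)) \<le> (1 + s * \<beta>) * norm (\<Psi> a k - \<Psi> r k)"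
        using X[of "\<Psi> a k - \<Psi> r k"] by (simp add: linear_diff[OF linX])
      also have "\<dots> \<le> (1 + s * \<beta>) * (norm (a k - r k) + s * (\<gamma> * ?D))"
        using \<Psi> \<open>k \<in> _\<close> \<open>0 \<le> s\<close> \<open>0 \<le> \<beta>\<close> by (intro mult_left_mono) auto
      finally show "norm (X (\<Psi> a k) - X (\<Psi> r k)) \<le> (1 + s * \<beta>) * (norm (a k - r k) + s * (\<gamma> * ?D))" .
    qed
    also have "\<dots> = (1 + s * \<beta>) * (1 + s * (q * \<gamma>)) * ?D"
      by (simp add: sum_distrib_left[symmetric] sum.distrib algebra_simps)
    finally show "(\<Sum>k<q. norm (X (\<Psi> a k) - X (\<Psi> r k))) \<le> (1 + s * \<beta>) * (1 + s * (q * \<gamma>)) * ?D" .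
  qed
  then show ?thesis by (simp only: X_def \<Psi>_def)
qed

text \<open>A basis chosen among the \<open>a\<^sub>k\<close> stays independent under small perturbations.\<close>

lemma dim_less_if_rdist_eq_0:
  fixes a :: "nat \<Rightarrow> 'a::euclidean_space"
  assumes "0 < p" and zero: "rdist p q a = 0"
  shows "dim (a ` {..<q}) < p"
proof (rule ccontr)
  assume "\<not> ?thesis"
  then have p: "p \<le> dim (a ` {..<q})" by simp
  obtain B where B: "B \<subseteq> a ` {..<q}" "independent B" "card B = dim (a ` {..<q})"
    using basis_exists[of "a ` {..<q}"] by metis
  have finB: "finite B" using finite_subset[OF B(1)] by simp
  have "\<forall>b\<in>B. \<exists>k. k < q \<and> a k = b" using B(1) by fastforce
  from bchoice[OF this] obtain i where i: "\<And>b. b \<in> B \<Longrightarrow> i b < q \<and> a (i b) = b" by blast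
  \<comment> \<open>Coordinate functionals of the basis \<open>B\<close>, extended to the whole
    space.\<close>
  have "\<forall>b. \<exists>f :: 'a \<Rightarrow> real. linear f \<and> (\<forall>x\<in>B. f x = (if x = b then 1 else 0))"
    by (intro allI linear_independent_extend[OF B(2)])
  then obtain f :: "'a \<Rightarrow> 'a \<Rightarrow> real" where f: "\<And>b. linear (f b)" "\<And>b x. x \<in> B \<Longrightarrow> f b x = (if x = b then 1 else 0)"
    by metis
  obtain K where K: "\<And>b x. norm (f b x) \<le> norm x * K b" "\<And>b. 0 < K b"
    using bounded_linear.pos_bounded[OF linear_linear[THEN iffD2, OF f(1)]] by metis
  define C where "C = (\<Sum>b\<in>B. K b) + 1"
  have C: "K b \<le> C" if "b \<in> B" for b
    using member_le_sum[OF that, of K] finB K(2) by (force simp: C_def intro: less_imp_le)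
  have C0: "0 < C" unfolding C_def using K(2) by (intro add_nonneg_pos sum_nonneg) (auto intro: less_imp_le)
  have "1 / C \<le> rdist p q a"
  proof (rule rdist_greatest[OF \<open>0 < p\<close>], rule ccontr)
    fix r :: "nat \<Rightarrow> 'a"
    assume r: "dim (r ` {..<q}) < p" and "\<not> 1 / C \<le> (\<Sum>k<q. norm (a k - r k))"
    then have small: "C * (\<Sum>k<q. norm (a k - r k)) < 1" using C0 by (simp add: field_simps)
    \<comment> \<open>\<open>X\<close> carries each basis vector \<open>b = a (i b)\<close> to
      \<open>r (i b)\<close>. It differs from the identity by an operator of norm less than
      \<open>1\<close> because \<open>r\<close> is closer to \<open>a\<close> than
      \<open>1 / C\<close>, so it is injective and \<open>r\<close> has at least the rank of
      \<open>a\<close>.\<close>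
    define X where "X = (\<lambda>x. x + (\<Sum>b\<in>B. f b x *\<^sub>R (r (i b) - b)))"
    have linX: "linear X"
      unfolding X_def using f(1)
      by (intro linear_compose_add linear_id[unfolded id_def] linear_compose_sum ballI)
         (auto intro!: linearI simp: linear_add linear_scale scaleR_left_distrib)
    have injB: "inj_on i B" using i by (metis inj_onI)
    have sumB: "(\<Sum>b\<in>B. norm (r (i b) - b)) \<le> (\<Sum>k<q. norm (a k - r k))"
    proof -
      have "(\<Sum>b\<in>B. norm (r (i b) - b)) = (\<Sum>k\<in>i ` B. norm (a k - r k))"
        using i by (subst sum.reindex[OF injB]) (auto simp: norm_minus_commute intro!: sum.cong)
      also have "\<dots> \<le> (\<Sum>k<q. norm (a k - r k))"
        using i by (intro sum_mono2) auto
      finally show ?thesis .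
    qed
    have "inj X"
    proof (subst linear_injective_0[OF linX], intro allI impI)
      fix x assume "X x = 0"
      then have "x = - (\<Sum>b\<in>B. f b x *\<^sub>R (r (i b) - b))"
        unfolding X_def by (simp add: eq_neg_iff_add_eq_0)
      then have "norm x = norm (\<Sum>b\<in>B. f b x *\<^sub>R (r (i b) - b))" by (metis norm_minus_cancel)
      also have "\<dots> \<le> (\<Sum>b\<in>B. norm x * C * norm (r (i b) - b))"
      proof (rule sum_norm_le)
        fix b assume "b \<in> B"
        have "norm (f b x) \<le> norm x * C"
          using K(1)[of b x] mult_left_mono[OF C[OF \<open>b \<in> B\<close>], of "norm x"] by simp
        then show "norm (f b x *\<^sub>R (r (i b) - b)) \<le> norm x * C * norm (r (i b) - b)"
          by (simp add: mult_right_mono)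
      qed
      also have "\<dots> = norm x * (C * (\<Sum>b\<in>B. norm (r (i b) - b)))"
        by (simp add: sum_distrib_left algebra_simps)
      also have "\<dots> \<le> norm x * (C * (\<Sum>k<q. norm (a k - r k)))"
        using sumB C0 by (intro mult_left_mono) auto
      finally have "norm x * (1 - C * (\<Sum>k<q. norm (a k - r k))) \<le> 0" by (simp add: algebra_simps)
      then show "x = 0" using small by (simp add: mult_le_0_iff)
    qed
    then have injX: "inj_on X A" for A by (rule inj_on_subset) simp
    have "independent (X ` B)" by (rule linear_independent_injective_image[OF linX B(2) injX])
    moreover have "X b = r (i b)" if "b \<in> B" for b
    proof -
      have "(\<Sum>b'\<in>B. f b' b *\<^sub>R (r (i b') - b')) = (\<Sum>b'\<in>B. if b' = b then r (i b') - b' else 0)"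
        using f(2)[OF that] by (intro sum.cong) auto
      then show ?thesis using that finB by (simp add: X_def)
    qed
    then have "X ` B \<subseteq> r ` {..<q}" using i by auto
    ultimately have "card (X ` B) \<le> dim (r ` {..<q})" by (intro independent_card_le_dim)
    moreover have "card (X ` B) = card B" by (rule card_image[OF injX])
    ultimately show False using r p B(3) by simp
  qed
  then show False using zero C0 by (simp add: divide_le_0_iff)
qed

section \<open>Propagation of the rank along subunit paths\<close>

lemma has_derivative_directional_remainder:
  fixes f :: "'a::real_normed_vector \<Rightarrow> 'b::real_normed_vector"
  assumes "(f has_derivative D) (at y)"
  shows "((\<lambda>s. norm (f (y + s *\<^sub>R v) - f y - s *\<^sub>R D v) / s) \<longlongrightarrow> 0) (at_right 0)"
proof -
  interpret D: bounded_linear D using assms by (rule has_derivative_bounded_linear)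
  have g: "((\<lambda>s. y + s *\<^sub>R v) has_derivative (\<lambda>s. s *\<^sub>R v)) (at 0)"
    by (auto intro!: derivative_eq_intros)
  have "((\<lambda>s. f (y + s *\<^sub>R v)) has_derivative (\<lambda>s. D (s *\<^sub>R v))) (at 0)"
    using has_derivative_compose[OF g, of f D] assms by simp
  then have "((\<lambda>s. norm (f (y + s *\<^sub>R v) - f y - D (s *\<^sub>R v)) / norm s) \<longlongrightarrow> 0) (at 0)"
    by (simp add: has_derivative_at)
  then have "((\<lambda>s. norm (f (y + s *\<^sub>R v) - f y - s *\<^sub>R D v) / \<bar>s\<bar>) \<longlongrightarrow> 0) (at_right 0)"
    by (simp add: D.scaleR filterlim_at_split)
  moreover have "\<forall>\<^sub>F s in at_right 0. norm (f (y + s *\<^sub>R v) - f y - s *\<^sub>R D v) / \<bar>s\<bar> = norm (f (y + s *\<^sub>R v) - f y - s *\<^sub>R D v) / s"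
    using eventually_at_right_less[of 0] by eventually_elim simp
  ultimately show ?thesis by (rule Lim_transform_eventually)
qed

lemma has_derivative_norm_le_lipschitz:
  fixes f :: "'a::real_normed_vector \<Rightarrow> 'b::real_normed_vector"
  assumes der: "(f has_derivative D) (at y)" and lip: "L-lipschitz_on UNIV f"
  shows "norm (D v) \<le> L * norm v"
proof -
  have "((\<lambda>s. L * norm v + norm (f (y + s *\<^sub>R v) - f y - s *\<^sub>R D v) / s) \<longlongrightarrow> L * norm v + 0) (at_right 0)"
    by (intro tendsto_add tendsto_const has_derivative_directional_remainder[OF der])
  moreover have "\<forall>\<^sub>F s in at_right 0. norm (D v) \<le> L * norm v + norm (f (y + s *\<^sub>R v) - f y - s *\<^sub>R D v) / s"
    using eventually_at_right_less[of 0]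
  proof eventually_elim
    case (elim s)
    have "norm (s *\<^sub>R D v) \<le> norm (f (y + s *\<^sub>R v) - f y) + norm (f (y + s *\<^sub>R v) - f y - s *\<^sub>R D v)"
      using norm_triangle_ineq4[of "f (y + s *\<^sub>R v) - f y" "f (y + s *\<^sub>R v) - f y - s *\<^sub>R D v"] by simp
    moreover have "norm (f (y + s *\<^sub>R v) - f y) \<le> L * (s * norm v)"
      using lipschitz_onD[OF lip, of "y + s *\<^sub>R v" y] elim by (simp add: dist_norm)
    ultimately have "s * norm (D v) \<le> s * (L * norm v) + norm (f (y + s *\<^sub>R v) - f y - s *\<^sub>R D v)"
      using elim by (simp add: algebra_simps)
    then show ?case using elim by (simp add: field_simps)
  qed
  ultimately have "norm (D v) \<le> L * norm v + 0"
    by (intro tendsto_lowerbound) auto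
  then show ?thesis by simp
qed

text \<open>The bracket relation gives \<open>Dg\<^sub>k v = B g\<^sub>k + \<Sum>\<^sub>l c\<^sub>k\<^sub>l g\<^sub>l\<close> with \<open>B = \<Sum>\<^sub>j u\<^sub>j Dg\<^sub>j\<close>, so to first order the matrix
  of the fields is multiplied on both sides by matrices close to the identity, which preserve the rank.\<close>

lemma rdist_quotient_le_at_involutive_point:
  fixes g :: "nat \<Rightarrow> 'a::euclidean_space \<Rightarrow> 'a"
  assumes "0 < p" and lip: "\<And>k. k < q \<Longrightarrow> L-lipschitz_on UNIV (g k)" and "0 \<le> L"
    and der: "\<And>k. k < q \<Longrightarrow> (g k has_derivative D k) (at y)"
    and brk: "\<And>j k. j < q \<Longrightarrow> k < q \<Longrightarrow>
      \<exists>c. (\<forall>l<q. \<bar>c l\<bar> \<le> C) \<and> D k (g j y) - D j (g k y) = (\<Sum>l<q. c l *\<^sub>R g l y)"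
    and "0 \<le> C" and u: "\<And>j. j < q \<Longrightarrow> \<bar>u j\<bar> \<le> 1" and "0 < e"
  shows "\<forall>\<^sub>F s in at_right 0. rdist p q (\<lambda>k. g k (y + s *\<^sub>R (\<Sum>j<q. u j *\<^sub>R g j y))) - rdist p q (\<lambda>k. g k y)
    \<le> ((q * L + q * (q * C)) * rdist p q (\<lambda>k. g k y) + e) * s"
proof -
  define v where "v = (\<Sum>j<q. u j *\<^sub>R g j y)"
  define H where "H = rdist p q (\<lambda>k. g k y)"
  have lin: "linear (D k)" if "k < q" for k
    using has_derivative_bounded_linear[OF der[OF that]] by (rule bounded_linear.linear)
  define B where "B = (\<lambda>x. \<Sum>j<q. u j *\<^sub>R D j x)"
  have linB: "linear B" unfolding B_def
    using lin by (intro linear_compose_sum ballI linear_compose_scale_right) auto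
  have normB: "norm (B x) \<le> (q * L) * norm x" for x
  proof -
    have "norm (B x) \<le> (\<Sum>j<q. L * norm x)"
      unfolding B_def
    proof (rule sum_norm_le)
      fix j assume "j \<in> {..<q}"
      then have "\<bar>u j\<bar> * norm (D j x) \<le> 1 * (L * norm x)"
        using u has_derivative_norm_le_lipschitz[OF der lip] by (intro mult_mono) auto
      then show "norm (u j *\<^sub>R D j x) \<le> L * norm x" by simp
    qed
    then show ?thesis by (simp add: algebra_simps)
  qed
  define cc where "cc = (\<lambda>j k. SOME c. (\<forall>l<q. \<bar>c l\<bar> \<le> C) \<and> D k (g j y) - D j (g k y) = (\<Sum>l<q. c l *\<^sub>R g l y))"
  have cc: "(\<forall>l<q. \<bar>cc j k l\<bar> \<le> C) \<and> D k (g j y) - D j (g k y) = (\<Sum>l<q. cc j k l *\<^sub>R g l y)"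
    if "j < q" "k < q" for j k
    unfolding cc_def by (rule someI_ex[OF brk[OF that]])
  \<comment> \<open>Adding up \<open>q\<close> brackets with weights of size at most
    \<open>1\<close> turns the bound \<open>C\<close> into \<open>q * C\<close>; the other
    \<open>q\<close> in the final rate comes from the length of the tuple.\<close>
  define c where "c = (\<lambda>k l. \<Sum>j<q. u j * cc j k l)"
  have c_bound: "\<bar>c k l\<bar> \<le> q * C" if "k < q" "l < q" for k l
  proof -
    have "\<bar>c k l\<bar> \<le> (\<Sum>j<q. \<bar>u j * cc j k l\<bar>)" unfolding c_def by (rule sum_abs)
    also have "\<dots> \<le> (\<Sum>j<q. 1 * C)"
      unfolding abs_mult using u cc that by (intro sum_mono mult_mono) auto
    finally show ?thesis by simp
  qed
  define S where "S = (\<lambda>k. \<Sum>l<q. c k l *\<^sub>R g l y)"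
  have Dv: "D k v = B (g k y) + S k" if k: "k < q" for k
  proof -
    have "D k v = (\<Sum>j<q. u j *\<^sub>R D k (g j y))"
      unfolding v_def by (simp add: linear_sum[OF lin[OF k]] linear_scale[OF lin[OF k]])
    also have "\<dots> = (\<Sum>j<q. u j *\<^sub>R (D j (g k y) + (\<Sum>l<q. cc j k l *\<^sub>R g l y)))"
    proof (rule sum.cong[OF refl])
      fix j assume "j \<in> {..<q}"
      then have "D k (g j y) = D j (g k y) + (\<Sum>l<q. cc j k l *\<^sub>R g l y)"
        using cc[of j k] k by (simp add: diff_eq_eq add.commute)
      then show "u j *\<^sub>R D k (g j y) = u j *\<^sub>R (D j (g k y) + (\<Sum>l<q. cc j k l *\<^sub>R g l y))" by simp
    qed
    also have "\<dots> = B (g k y) + (\<Sum>j<q. \<Sum>l<q. (u j * cc j k l) *\<^sub>R g l y)"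
      by (simp add: B_def scaleR_add_right sum.distrib scaleR_sum_right)
    also have "(\<Sum>j<q. \<Sum>l<q. (u j * cc j k l) *\<^sub>R g l y) = S k"
      unfolding S_def c_def scaleR_sum_left by (rule sum.swap)
    finally show ?thesis .
  qed
  define \<beta> where "\<beta> = q * L"
  define \<kappa> where "\<kappa> = q * (q * C)"
  \<comment> \<open>The first-order prediction in product form: it equals
    \<open>g k y + s *\<^sub>R D k v\<close> up to \<open>s * s\<close> times
    \<open>B (S k)\<close>, and its rank distance is bounded by the transformation estimate.\<close>
  define w where "w = (\<lambda>s k. (g k y + s *\<^sub>R S k) + s *\<^sub>R B (g k y + s *\<^sub>R S k))"
  \<comment> \<open>\<open>s * \<psi> s\<close> collects the whole bound on the increase: the
    expansion of \<open>(1 + s * \<beta>) * (1 + s * \<kappa>) * H\<close> without \<open>H\<close>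
    itself, and the remainders. Only \<open>(\<beta> + \<kappa>) * H\<close> survives in the
    limit.\<close>
  define \<psi> where "\<psi> = (\<lambda>s. (\<beta> + \<kappa>) * H + s * (\<beta> * \<kappa> * H)
      + (\<Sum>k<q. norm (g k (y + s *\<^sub>R v) - g k y - s *\<^sub>R D k v) / s + s * norm (B (S k))))"
  have "(\<psi> \<longlongrightarrow> (\<beta> + \<kappa>) * H + 0 * (\<beta> * \<kappa> * H) + (\<Sum>k<q. 0 + 0 * norm (B (S k)))) (at_right 0)"
    unfolding \<psi>_def
    by (intro tendsto_add tendsto_sum tendsto_mult tendsto_const tendsto_ident_at
        has_derivative_directional_remainder[OF der]) auto
  then have "(\<psi> \<longlongrightarrow> (\<beta> + \<kappa>) * H) (at_right 0)" by simp
  then have "\<forall>\<^sub>F s in at_right 0. \<psi> s < (\<beta> + \<kappa>) * H + e"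
    using \<open>0 < e\<close> by (intro order_tendstoD) auto
  then have "\<forall>\<^sub>F s in at_right 0. rdist p q (\<lambda>k. g k (y + s *\<^sub>R v)) - H \<le> ((\<beta> + \<kappa>) * H + e) * s"
    using eventually_at_right_less[of 0]
  proof eventually_elim
    case (elim s)
    have "rdist p q (\<lambda>k. g k (y + s *\<^sub>R v)) \<le> rdist p q (w s) + (\<Sum>k<q. norm (g k (y + s *\<^sub>R v) - w s k))"
      by (rule rdist_triangle[OF \<open>0 < p\<close>])
    also have "rdist p q (w s) \<le> (1 + s * \<beta>) * (1 + s * \<kappa>) * H"
      unfolding w_def S_def H_def \<beta>_def \<kappa>_def
      using elim \<open>0 \<le> L\<close> \<open>0 \<le> C\<close>
      by (intro rdist_infinitesimal_transform_le[OF \<open>0 < p\<close> linB normB _ c_bound]) auto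
    also have "(\<Sum>k<q. norm (g k (y + s *\<^sub>R v) - w s k))
        \<le> (\<Sum>k<q. s * (norm (g k (y + s *\<^sub>R v) - g k y - s *\<^sub>R D k v) / s + s * norm (B (S k))))"
    proof (rule sum_mono)
      fix k assume "k \<in> {..<q}"
      then have "w s k = g k y + s *\<^sub>R D k v + (s * s) *\<^sub>R B (S k)"
        by (simp add: w_def Dv linear_add[OF linB] linear_scale[OF linB] algebra_simps)
      then have "g k (y + s *\<^sub>R v) - w s k = (g k (y + s *\<^sub>R v) - g k y - s *\<^sub>R D k v) - (s * s) *\<^sub>R B (S k)"
        by simp
      also have "norm \<dots> \<le> norm (g k (y + s *\<^sub>R v) - g k y - s *\<^sub>R D k v) + norm ((s * s) *\<^sub>R B (S k))"
        by (rule norm_triangle_ineq4)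
      also have "\<dots> = s * (norm (g k (y + s *\<^sub>R v) - g k y - s *\<^sub>R D k v) / s + s * norm (B (S k)))"
        using elim by (simp add: distrib_left)
      finally show "norm (g k (y + s *\<^sub>R v) - w s k)
          \<le> s * (norm (g k (y + s *\<^sub>R v) - g k y - s *\<^sub>R D k v) / s + s * norm (B (S k)))" .
    qed
    finally have "rdist p q (\<lambda>k. g k (y + s *\<^sub>R v)) - H \<le> s * \<psi> s"
      by (simp add: \<psi>_def sum_distrib_left algebra_simps)
    also have "\<dots> \<le> s * ((\<beta> + \<kappa>) * H + e)" using elim by (intro mult_left_mono) auto
    finally show ?case by (simp add: mult.commute)
  qed
  then show ?thesis by (simp add: v_def H_def \<beta>_def \<kappa>_def)
qed

lemma lipschitz_on_rdist:
  fixes g :: "nat \<Rightarrow> 'a::euclidean_space \<Rightarrow> 'a"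
  assumes "0 < p" and lip: "\<And>k. k < q \<Longrightarrow> L-lipschitz_on UNIV (g k)" and "0 \<le> L"
  shows "(q * L)-lipschitz_on UNIV (\<lambda>x. rdist p q (\<lambda>k. g k x))"
proof (rule lipschitz_onI)
  fix x y :: 'a
  have le: "rdist p q (\<lambda>k. g k x) - rdist p q (\<lambda>k. g k y) \<le> q * L * dist x y" for x y
  proof -
    have "(\<Sum>k<q. norm (g k x - g k y)) \<le> (\<Sum>k<q. L * dist x y)"
      using lipschitz_onD[OF lip] by (intro sum_mono) (auto simp: dist_norm)
    then show ?thesis
      using rdist_triangle[OF \<open>0 < p\<close>, of q "\<lambda>k. g k x" "\<lambda>k. g k y"] by simp
  qed
  show "dist (rdist p q (\<lambda>k. g k x)) (rdist p q (\<lambda>k. g k y)) \<le> q * L * dist x y"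
    using le[of x y] le[of y x] by (simp add: dist_real_def dist_commute abs_le_iff)
qed (use \<open>0 \<le> L\<close> in simp)

text \<open>Global Lipschitz bounds together with a bracket relation known only inside
  \<open>U\<close>: the situation reached once the fields have been modified away from the
  path.\<close>

locale AE_involutive =
  fixes p q :: nat and g :: "nat \<Rightarrow> 'a::euclidean_space \<Rightarrow> 'a" and L C :: real and U :: "'a set"
  assumes p_pos: "0 < p" and lip: "\<And>k. k < q \<Longrightarrow> L-lipschitz_on UNIV (g k)" and L_nonneg: "0 \<le> L" and C_nonneg: "0 \<le> C"
    and open_U: "open U"
    and inv: "AE y in lborel. y \<in> U \<longrightarrow> (\<exists>D. (\<forall>k<q. (g k has_derivative D k) (at y)) \<and>
      (\<forall>j<q. \<forall>k<q. \<exists>c. (\<forall>l<q. \<bar>c l\<bar> \<le> C) \<and> D k (g j y) - D j (g k y) = (\<Sum>l<q. c l *\<^sub>R g l y)))"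
begin

definition H :: "'a \<Rightarrow> real" where "H x = rdist p q (\<lambda>k. g k x)"

definition vf :: "(nat \<Rightarrow> real) \<Rightarrow> 'a \<Rightarrow> 'a" where "vf u x = (\<Sum>j<q. u j *\<^sub>R g j x)"

definition K :: real where "K = q * L + q * (q * C)"

lemma lipschitz_H: "(q * L)-lipschitz_on UNIV H"
  unfolding H_def by (rule lipschitz_on_rdist[OF p_pos lip L_nonneg])

lemma H_le: "H x \<le> H y + q * L * norm (x - y)"
  using lipschitz_onD[OF lipschitz_H, of x y] by (simp add: dist_norm dist_real_def abs_le_iff)

lemma K_nonneg: "0 \<le> K"
  using L_nonneg C_nonneg by (simp add: K_def)

text \<open>The direction is frozen at \<open>vf u x\<close>, while the rank estimate at a nearby
  \<open>y\<close> concerns \<open>vf u y\<close>. The discrepancy costs \<open>q * L\<close> times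
  the norm of their difference, small near \<open>x\<close> by continuity, so one rate serves almost
  all points of a small ball. Averaging then reaches \<open>x\<close> itself, where the fields may
  fail to be differentiable.\<close>

lemma H_quotient_le:
  assumes x: "x \<in> U" and u: "\<And>j. j < q \<Longrightarrow> \<bar>u j\<bar> \<le> 1" and "0 < e"
  shows "\<forall>\<^sub>F t in at_right 0. H (x + t *\<^sub>R vf u x) - H x \<le> (K * H x + e) * t"
proof -
  define v where "v = vf u x"
  define c where "c = K * H x + e"
  have contH: "continuous_on UNIV H" by (rule lipschitz_on_continuous_on[OF lipschitz_H])
  have contv: "continuous_on UNIV (vf u)"
    unfolding vf_def using lip
    by (intro continuous_on_sum continuous_on_scaleR continuous_on_const lipschitz_on_continuous_on) auto
  have "open {y. K * H y + q * L * norm (v - vf u y) < c}"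
    by (intro open_Collect_less continuous_intros contH contv)
  then have "open ({y. K * H y + q * L * norm (v - vf u y) < c} \<inter> U)"
    using open_U by (rule open_Int)
  moreover have "x \<in> {y. K * H y + q * L * norm (v - vf u y) < c} \<inter> U"
    using \<open>0 < e\<close> x by (simp add: c_def v_def)
  ultimately obtain r where r0: "0 < r" "ball x r \<subseteq> {y. K * H y + q * L * norm (v - vf u y) < c} \<inter> U"
    by (rule openE)
  then have r: "0 < r" "K * H y + q * L * norm (v - vf u y) < c \<and> y \<in> U" if "y \<in> ball x r" for y
    using that by blast+
  have ae: "AE y in lborel. y \<in> ball x r \<longrightarrow> (\<forall>e>0. \<forall>\<^sub>F d in at_right 0. H (y + d *\<^sub>R v) - H y \<le> (c + e) * d)"
    using inv
  proof eventually_elim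
    case (elim y)
    show ?case
    proof (intro impI allI)
      fix e' :: real assume y: "y \<in> ball x r" and "0 < e'"
      obtain D where D: "\<forall>k<q. (g k has_derivative D k) (at y)"
        "\<forall>j<q. \<forall>k<q. \<exists>c. (\<forall>l<q. \<bar>c l\<bar> \<le> C) \<and> D k (g j y) - D j (g k y) = (\<Sum>l<q. c l *\<^sub>R g l y)"
        using elim r(2)[OF y] by blast
      have "\<forall>\<^sub>F s in at_right 0. H (y + s *\<^sub>R vf u y) - H y \<le> (K * H y + e') * s"
        unfolding H_def vf_def K_def
        by (rule rdist_quotient_le_at_involutive_point[OF p_pos lip L_nonneg _ _ C_nonneg u \<open>0 < e'\<close>]) (use D in auto)
      then show "\<forall>\<^sub>F d in at_right 0. H (y + d *\<^sub>R v) - H y \<le> (c + e') * d"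
        using eventually_at_right_less[of 0]
      proof eventually_elim
        case (elim d)
        have "H (y + d *\<^sub>R v) \<le> H (y + d *\<^sub>R vf u y) + q * L * norm (d *\<^sub>R (v - vf u y))"
          using H_le[of "y + d *\<^sub>R v" "y + d *\<^sub>R vf u y"] by (simp add: scaleR_diff_right)
        moreover have "norm (d *\<^sub>R (v - vf u y)) = d * norm (v - vf u y)" using elim by simp
        ultimately have "H (y + d *\<^sub>R v) - H y \<le> (K * H y + q * L * norm (v - vf u y) + e') * d"
          using elim by (simp add: algebra_simps)
        also have "\<dots> \<le> (c + e') * d"
          using elim r(2)[OF y] by (intro mult_right_mono) auto
        finally show ?case .
      qed
    qed
  qed
  have "H (x + t *\<^sub>R v) - H x \<le> c * t" if t: "0 < t" "t < r / (norm v + 1)" for t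
  proof (rule lipschitz_increment_le_if_AE_quotient_le[OF lipschitz_H _ _ _ t(1) ae])
    have "t * norm v \<le> t * (norm v + 1)" using t by simp
    also have "\<dots> < r" using t by (simp add: pos_less_divide_eq add_nonneg_pos)
    finally have "x + t *\<^sub>R v \<in> ball x r" using t by (simp add: dist_norm)
    then show "closed_segment x (x + t *\<^sub>R v) \<subseteq> ball x r"
      using r0(1) by (intro closed_segment_subset) auto
  qed auto
  moreover have "0 < r / (norm v + 1)" using r0(1) by (simp add: add_nonneg_pos)
  ultimately have "\<forall>\<^sub>F t in at_right 0. H (x + t *\<^sub>R v) - H x \<le> c * t"
    by (auto simp: eventually_at_right_field)
  then show ?thesis by (simp add: v_def c_def)
qed

lemma H_eq_0_along_path:
  assumes "0 \<le> T" and lip\<gamma>: "M-lipschitz_on {0..T} \<gamma>" and sub: "\<gamma> ` {0..T} \<subseteq> U"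
    and path: "AE t in lborel. t \<in> {0..T} \<longrightarrow>
      (\<exists>u. (\<forall>j<q. \<bar>u j\<bar> \<le> 1) \<and> (\<gamma> has_vector_derivative vf u (\<gamma> t)) (at t))"
    and "H (\<gamma> 0) = 0"
  shows "H (\<gamma> T) = 0"
proof (rule gronwall_AE_eq_0[where \<phi>="\<lambda>s. H (\<gamma> s)" and K=K])
  have "(q * L * M)-lipschitz_on {0..T} (H \<circ> \<gamma>)"
    using lipschitz_on_subset[OF lipschitz_H] by (intro lipschitz_on_compose lip\<gamma>) auto
  then show "(q * L * M)-lipschitz_on {0..T} (\<lambda>s. H (\<gamma> s))" by (simp add: o_def)
  show "AE s in lborel. s \<in> {0<..<T} \<longrightarrow>
      (\<forall>e>0. \<forall>\<^sub>F d in at_right 0. H (\<gamma> (s + d)) - H (\<gamma> s) \<le> (K * H (\<gamma> s) + e) * d)"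
    using path
  proof eventually_elim
    case (elim s)
    show ?case
    proof (intro impI allI)
      fix e :: real assume s: "s \<in> {0<..<T}" and "0 < e"
      obtain u where u: "\<And>j. j < q \<Longrightarrow> \<bar>u j\<bar> \<le> 1" and der: "(\<gamma> has_vector_derivative vf u (\<gamma> s)) (at s)"
        using elim s by auto
      \<comment> \<open>Half of \<open>e\<close> goes to the segment, half to the remainder of the
        path, which \<open>H\<close> magnifies by at most \<open>q * L\<close>; the
        \<open>+ 1\<close> keeps the divisor positive.\<close>
      define \<epsilon> where "\<epsilon> = e / 2 / (q * L + 1)"
      have qL: "0 < q * L + 1" using L_nonneg by (intro add_nonneg_pos) auto
      have \<epsilon>: "0 < \<epsilon>" "(q * L + 1) * \<epsilon> = e / 2"
        unfolding \<epsilon>_def using \<open>0 < e\<close> qL by (simp, subst times_divide_eq_right, subst nonzero_mult_div_cancel_left) auto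
      then have \<epsilon>': "q * L * \<epsilon> \<le> e / 2" by (simp add: distrib_right)
      have "(\<gamma> has_derivative (\<lambda>h. h *\<^sub>R vf u (\<gamma> s))) (at s)"
        using der by (simp add: has_vector_derivative_def)
      from has_derivative_directional_remainder[OF this, of 1]
      have "\<forall>\<^sub>F d in at_right 0. norm (\<gamma> (s + d) - \<gamma> s - d *\<^sub>R vf u (\<gamma> s)) / d < \<epsilon>"
        using order_tendstoD(2)[of _ 0 "at_right 0" \<epsilon>] \<epsilon>(1) by simp
      moreover have "\<forall>\<^sub>F d in at_right 0. H (\<gamma> s + d *\<^sub>R vf u (\<gamma> s)) - H (\<gamma> s) \<le> (K * H (\<gamma> s) + e / 2) * d"
        by (rule H_quotient_le) (use sub s u \<open>0 < e\<close> in auto)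
      ultimately show "\<forall>\<^sub>F d in at_right 0. H (\<gamma> (s + d)) - H (\<gamma> s) \<le> (K * H (\<gamma> s) + e) * d"
        using eventually_at_right_less[of 0]
      proof eventually_elim
        case (elim d)
        let ?n = "norm (\<gamma> (s + d) - \<gamma> s - d *\<^sub>R vf u (\<gamma> s))"
        have "H (\<gamma> (s + d)) \<le> H (\<gamma> s + d *\<^sub>R vf u (\<gamma> s)) + q * L * ?n"
          using H_le[of "\<gamma> (s + d)" "\<gamma> s + d *\<^sub>R vf u (\<gamma> s)"] by (simp add: algebra_simps)
        moreover have "q * L * ?n \<le> q * L * (\<epsilon> * d)"
          using elim L_nonneg by (intro mult_left_mono) (auto simp: divide_less_eq)
        moreover have "q * L * (\<epsilon> * d) \<le> e / 2 * d"
          using mult_right_mono[OF \<epsilon>', of d] elim by (simp add: mult.assoc)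
        ultimately have "H (\<gamma> (s + d)) - H (\<gamma> s) \<le> (K * H (\<gamma> s) + e / 2) * d + e / 2 * d"
          using elim by linarith
        then show ?case by (simp add: algebra_simps)
      qed
    qed
  qed
qed (use assms K_nonneg in \<open>auto simp: H_def rdist_nonneg[OF p_pos]\<close>)

end

section \<open>Localisation near a path and time reversal\<close>

lemma loc_lipschitz_imp_lipschitz_on_compact:
  fixes f :: "'a::metric_space \<Rightarrow> 'b::metric_space"
  assumes "loc_lipschitz f" "compact X"
  obtains L where "L-lipschitz_on X f"
proof -
  have ball: "\<exists>r>0. \<exists>L. L-lipschitz_on (ball x r) f" for x
    using assms(1) by (simp add: loc_lipschitz_def)
  \<comment> \<open>The function is viewed as depending on a time that takes only the value
    \<open>0\<close>, the setting of the compactness result used next.\<close>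
  have "local_lipschitz {0::real} X (\<lambda>_. f)"
  proof (rule local_lipschitzI)
    fix t :: real and x
    obtain r L where r: "0 < r" "L-lipschitz_on (ball x r) f" using ball by blast
    have "cball x (r / 2) \<inter> X \<subseteq> ball x r" using r(1) by auto
    then have "L-lipschitz_on (cball x (r / 2) \<inter> X) f" using lipschitz_on_subset[OF r(2)] by blast
    then show "\<exists>u>0. \<exists>L. \<forall>t'\<in>cball t u \<inter> {0}. L-lipschitz_on (cball x u \<inter> X) f"
      using r(1) by (intro exI[of _ "r / 2"]) auto
  qed
  then show thesis
    using local_lipschitz_compact_implies_lipschitz[where X=X and T="{0::real}" and f="\<lambda>_. f"] assms(2) that by auto
qed

lemma AE_lborel_reflect:
  fixes T :: real
  assumes "AE s in lborel. P s" shows "AE s in lborel. P (T - s)"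
proof -
  have "distr lborel borel (\<lambda>s. T + - 1 * s) = lborel"
    using lborel_real_affine[of "- 1" T] by (simp add: density_1 one_ennreal_def[symmetric])
  then have "AE s in distr lborel borel (\<lambda>s. T + - 1 * s). P s" using assms by (simp only:)
  from AE_distrD[OF _ this] show ?thesis by simp
qed

lemma abs_le_if_sqrt_sum_le:
  fixes c :: "nat \<Rightarrow> real"
  assumes "sqrt (\<Sum>j<q. (c j)\<^sup>2) \<le> r" "k < q" shows "\<bar>c k\<bar> \<le> r"
proof -
  have "(c k)\<^sup>2 \<le> (\<Sum>j<q. (c j)\<^sup>2)" using assms(2) by (intro member_le_sum) auto
  then have "sqrt ((c k)\<^sup>2) \<le> sqrt (\<Sum>j<q. (c j)\<^sup>2)" by (rule real_sqrt_le_mono)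
  then show ?thesis using assms(1) by simp
qed

lemma px_eq_dim: "px q g x = dim ((\<lambda>k. g k x) ` {..<q})"
proof -
  have "{g j x | j. j < q} = (\<lambda>k. g k x) ` {..<q}" by auto
  then show ?thesis by (simp add: px_def Px_def)
qed

text \<open>Composing with the nearest-point projection onto a closed ball containing the path makes the
  fields globally Lipschitz without changing them near the path.\<close>

lemma px_less_along_path:
  fixes q :: nat and g :: "nat \<Rightarrow> real^'n \<Rightarrow> real^'n"
  assumes lip: "\<forall>j<q. loc_lipschitz (g j)"
    and H: "\<forall>\<Omega>. open \<Omega> \<and> bounded \<Omega> \<longrightarrow>
              (\<exists>C>0. AE x in lebesgue. x \<in> \<Omega> \<longrightarrow>
                 (\<forall>j<q. \<forall>k<q. g j differentiable (at x) \<and> g k differentiable (at x)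
                    \<longrightarrow> bracket g j k x \<in> Pr q g x C))"
    and "0 \<le> T" and lip\<gamma>: "M-lipschitz_on {0..T} \<gamma>"
    and path: "AE t in lborel. t \<in> {0..T} \<longrightarrow>
      (\<exists>u. (\<forall>j<q. \<bar>u j\<bar> \<le> 1) \<and> (\<gamma> has_vector_derivative (\<Sum>j<q. u j *\<^sub>R g j (\<gamma> t))) (at t))"
    and start: "px q g (\<gamma> 0) < p"
  shows "px q g (\<gamma> T) < p"
proof -
  have "0 < p" using start by simp
  have "compact (\<gamma> ` {0..T})"
    by (intro compact_continuous_image lipschitz_on_continuous_on[OF lip\<gamma>]) auto
  then obtain R where R: "0 < R" "\<gamma> ` {0..T} \<subseteq> ball 0 R"
    using bounded_subset_ballD[OF compact_imp_bounded] by blast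
  define \<pi> where "\<pi> = closest_point (cball (0 :: real^'n) R)"
  have \<pi>_id: "\<pi> x = x" if "x \<in> ball 0 R" for x
    unfolding \<pi>_def using that by (intro closest_point_self) auto
  have \<pi>_in: "\<pi> x \<in> cball 0 R" for x
    unfolding \<pi>_def using R by (intro closest_point_in_set) auto
  have \<pi>_dist: "dist (\<pi> x) (\<pi> y) \<le> dist x y" for x y
    unfolding \<pi>_def using R by (intro closest_point_lipschitz) auto
  define G where "G = (\<lambda>k x. g k (\<pi> x))"
  have G_eq: "G k x = g k x" if "x \<in> ball 0 R" for k x
    using \<pi>_id[OF that] by (simp add: G_def)
  have "\<exists>L. L-lipschitz_on (cball 0 R) (g k)" if "k < q" for k
    using loc_lipschitz_imp_lipschitz_on_compact[OF _ compact_cball] lip that by metis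
  then obtain l where l: "\<And>k. k < q \<Longrightarrow> (l k)-lipschitz_on (cball 0 R) (g k)" by metis
  define L where "L = (\<Sum>k<q. l k)"
  have l0: "0 \<le> l k" if "k < q" for k using lipschitz_on_nonneg[OF l[OF that]] .
  have L0: "0 \<le> L" unfolding L_def using l0 by (intro sum_nonneg) auto
  have lipG: "L-lipschitz_on UNIV (G k)" if k: "k < q" for k
  proof (rule lipschitz_onI)
    fix x y
    have "l k \<le> L" unfolding L_def using k l0 by (intro member_le_sum) auto
    have "dist (G k x) (G k y) \<le> l k * dist (\<pi> x) (\<pi> y)"
      unfolding G_def by (rule lipschitz_onD[OF l[OF k] \<pi>_in \<pi>_in])
    also have "\<dots> \<le> L * dist x y"
      using \<open>l k \<le> L\<close> L0 \<pi>_dist by (intro mult_mono) auto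
    finally show "dist (G k x) (G k y) \<le> L * dist x y" .
  qed (rule L0)
  obtain C where C: "0 < C" "AE x in lborel. x \<in> ball 0 R \<longrightarrow>
      (\<forall>j<q. \<forall>k<q. g j differentiable (at x) \<and> g k differentiable (at x) \<longrightarrow> bracket g j k x \<in> Pr q g x C)"
    using H[rule_format, of "ball 0 R"] unfolding AE_completion_iff by auto
  have "AE y in lborel. \<forall>k<q. G k differentiable (at y)"
  proof -
    have "AE y in lborel. \<forall>k\<in>{..<q}. G k differentiable (at y)"
      by (intro AE_finite_allI) (use Rademacher[OF lipG] in auto)
    then show ?thesis by eventually_elim auto
  qed
  then have inv: "AE y in lborel. y \<in> ball 0 R \<longrightarrow> (\<exists>D. (\<forall>k<q. (G k has_derivative D k) (at y)) \<and>
      (\<forall>j<q. \<forall>k<q. \<exists>c. (\<forall>l<q. \<bar>c l\<bar> \<le> C) \<and> D k (G j y) - D j (G k y) = (\<Sum>l<q. c l *\<^sub>R G l y)))"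
    using C(2)
  proof eventually_elim
    case (elim y)
    show ?case
    proof
      assume y: "y \<in> ball 0 R"
      define D where "D = (\<lambda>k. frechet_derivative (g k) (at y))"
      \<comment> \<open>\<open>G k\<close> and \<open>g k\<close> agree on an open ball around the
        origin containing \<open>y\<close>. Differentiability passes from \<open>G k\<close>, where
        Rademacher's theorem applies, to \<open>g k\<close>, whose derivative enters the bracket;
        that derivative then passes back to \<open>G k\<close>.\<close>
      have diff: "g k differentiable (at y)" and der: "(G k has_derivative D k) (at y)" if k: "k < q" for k
      proof -
        obtain D' where D': "(G k has_derivative D') (at y)"
          using elim(1) k unfolding differentiable_def by blast
        have "(g k has_derivative D') (at y)"
          by (rule has_derivative_transform_within_open[OF D' open_ball y]) (rule G_eq)
        then show d: "g k differentiable (at y)" by (rule differentiableI)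
        then have "(g k has_derivative D k) (at y)" unfolding D_def by (simp add: frechet_derivative_works)
        then show "(G k has_derivative D k) (at y)"
          by (rule has_derivative_transform_within_open[OF _ open_ball y]) (simp add: G_eq)
      qed
      have "\<exists>c. (\<forall>l<q. \<bar>c l\<bar> \<le> C) \<and> D k (G j y) - D j (G k y) = (\<Sum>l<q. c l *\<^sub>R G l y)" if jk: "j < q" "k < q" for j k
      proof -
        have "bracket g j k y \<in> Pr q g y C" using elim y jk diff by blast
        then obtain c where "bracket g j k y = (\<Sum>l<q. c l *\<^sub>R g l y)" "sqrt (\<Sum>l<q. (c l)\<^sup>2) \<le> C"
          unfolding Pr_def by blast
        then show ?thesis
          using abs_le_if_sqrt_sum_le[of c q C] by (intro exI[of _ c]) (auto simp: bracket_def D_def G_eq[OF y])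
      qed
      then show "\<exists>D. (\<forall>k<q. (G k has_derivative D k) (at y)) \<and>
          (\<forall>j<q. \<forall>k<q. \<exists>c. (\<forall>l<q. \<bar>c l\<bar> \<le> C) \<and> D k (G j y) - D j (G k y) = (\<Sum>l<q. c l *\<^sub>R G l y))"
        using der by blast
    qed
  qed
  interpret I: AE_involutive p q G L C "ball 0 R"
    by unfold_locales (use \<open>0 < p\<close> lipG L0 C(1) inv in auto)
  have H_eq: "I.H x = rdist p q (\<lambda>k. g k x)" if "x \<in> ball 0 R" for x
    unfolding I.H_def using G_eq[OF that] by simp
  have in_ball: "\<gamma> t \<in> ball 0 R" if "t \<in> {0..T}" for t using R(2) that by blast
  have "I.H (\<gamma> 0) \<le> 0"
    using rdist_le[of "\<lambda>k. g k (\<gamma> 0)" q p "\<lambda>k. g k (\<gamma> 0)"] start in_ball[of 0] \<open>0 \<le> T\<close>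
    by (simp add: H_eq px_eq_dim)
  then have "I.H (\<gamma> 0) = 0" unfolding I.H_def using rdist_nonneg[OF \<open>0 < p\<close>] by (intro antisym)
  moreover have "AE t in lborel. t \<in> {0..T} \<longrightarrow>
      (\<exists>u. (\<forall>j<q. \<bar>u j\<bar> \<le> 1) \<and> (\<gamma> has_vector_derivative I.vf u (\<gamma> t)) (at t))"
    using path
  proof eventually_elim
    case (elim t)
    then show ?case using G_eq[OF in_ball] by (simp add: I.vf_def)
  qed
  ultimately have "I.H (\<gamma> T) = 0"
    using I.H_eq_0_along_path[OF \<open>0 \<le> T\<close> lip\<gamma> R(2)] by blast
  then show ?thesis
    using dim_less_if_rdist_eq_0[OF \<open>0 < p\<close>, of q "\<lambda>k. g k (\<gamma> T)"] in_ball[of T] \<open>0 \<le> T\<close>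
    by (simp add: H_eq px_eq_dim)
qed

theorem theorem2p1:
  fixes q :: nat and g :: "nat \<Rightarrow> real^'n \<Rightarrow> real^'n"
  assumes lip: "\<forall>j<q. loc_lipschitz (g j)"
    and H: "\<forall>\<Omega>. open \<Omega> \<and> bounded \<Omega> \<longrightarrow>
              (\<exists>C>0. AE x in lebesgue. x \<in> \<Omega> \<longrightarrow>
                 (\<forall>j<q. \<forall>k<q. g j differentiable (at x) \<and> g k differentiable (at x)
                    \<longrightarrow> bracket g j k x \<in> Pr q g x C))"
  shows "\<forall>x0. \<forall>x \<in> orbit q g x0. px q g x = px q g x0"
proof (intro allI ballI)
  fix x0 x assume x: "x \<in> orbit q g x0"
  \<comment> \<open>The infimum of the empty set is \<open>top\<close>, so a finite distance
    provides a joining path.\<close>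
  have "{T. \<exists>\<gamma>. subunit_path q g T \<gamma> \<and> \<gamma> 0 = x0 \<and> \<gamma> T = x} \<noteq> {}" (is "?S \<noteq> {}")
  proof
    assume "?S = {}"
    then have "subunit_dist q g x0 x = top"
      unfolding subunit_dist_def by (simp only: image_empty Inf_empty)
    then show False using x by (simp add: orbit_def)
  qed
  then obtain T \<gamma> where path: "subunit_path q g T \<gamma>" and ends: "\<gamma> 0 = x0" "\<gamma> T = x" by blast
  obtain M u where T: "0 \<le> T" and lip\<gamma>: "M-lipschitz_on {0..T} \<gamma>"
    and u: "AE t in lebesgue_on {0..T}. sqrt (\<Sum>j<q. (u t j)\<^sup>2) \<le> 1"
      "AE t in lebesgue_on {0..T}. (\<gamma> has_vector_derivative (\<Sum>j<q. u t j *\<^sub>R g j (\<gamma> t))) (at t)"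
    using path unfolding subunit_path_def by blast
  have "AE t in lebesgue_on {0..T}. sqrt (\<Sum>j<q. (u t j)\<^sup>2) \<le> 1 \<and>
      (\<gamma> has_vector_derivative (\<Sum>j<q. u t j *\<^sub>R g j (\<gamma> t))) (at t)"
    using u by (rule AE_conjI)
  then have sub: "AE t in lborel. t \<in> {0..T} \<longrightarrow> sqrt (\<Sum>j<q. (u t j)\<^sup>2) \<le> 1 \<and>
      (\<gamma> has_vector_derivative (\<Sum>j<q. u t j *\<^sub>R g j (\<gamma> t))) (at t)"
    by (subst (asm) AE_restrict_space_iff) (auto simp: AE_completion_iff)
  have "AE t in lborel. t \<in> {0..T} \<longrightarrow>
      (\<exists>u. (\<forall>j<q. \<bar>u j\<bar> \<le> 1) \<and> (\<gamma> has_vector_derivative (\<Sum>j<q. u j *\<^sub>R g j (\<gamma> t))) (at t))"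
    using sub
  proof eventually_elim
    case (elim t)
    show ?case
      using elim abs_le_if_sqrt_sum_le[of "u t" q 1] by blast
  qed
  \<comment> \<open>With \<open>p = Suc (px q g x0)\<close> the strict bound holds trivially at the
    start; at the end it is the wanted inequality.\<close>
  from px_less_along_path[OF lip H T lip\<gamma> this, of "Suc (px q g x0)"]
  have 1: "px q g x \<le> px q g x0" by (simp add: ends)
  \<comment> \<open>The reversed path has the negated controls, which satisfy the same
    bound.\<close>
  define \<delta> where "\<delta> = (\<lambda>s. \<gamma> (T - s))"
  have "AE t in lborel. t \<in> {0..T} \<longrightarrow>
      (\<exists>u. (\<forall>j<q. \<bar>u j\<bar> \<le> 1) \<and> (\<delta> has_vector_derivative (\<Sum>j<q. u j *\<^sub>R g j (\<delta> t))) (at t))"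
    using AE_lborel_reflect[OF sub, of T]
  proof eventually_elim
    case (elim t)
    show ?case
    proof
      assume "t \<in> {0..T}"
      then have le: "sqrt (\<Sum>j<q. (u (T - t) j)\<^sup>2) \<le> 1"
        and der: "(\<gamma> has_vector_derivative (\<Sum>j<q. u (T - t) j *\<^sub>R g j (\<gamma> (T - t)))) (at (T - t))"
        using elim by auto
      have "((\<lambda>s. T - s) has_real_derivative - 1) (at t)" by (auto intro!: derivative_eq_intros)
      then have "((\<lambda>s. T - s) has_vector_derivative - 1) (at t)"
        by (simp add: has_real_derivative_iff_has_vector_derivative)
      from vector_diff_chain_at[OF this der]
      have "(\<delta> has_vector_derivative (\<Sum>j<q. (- u (T - t) j) *\<^sub>R g j (\<delta> t))) (at t)"
        by (simp add: \<delta>_def o_def sum_negf)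
      then show "\<exists>u. (\<forall>j<q. \<bar>u j\<bar> \<le> 1) \<and> (\<delta> has_vector_derivative (\<Sum>j<q. u j *\<^sub>R g j (\<delta> t))) (at t)"
        using abs_le_if_sqrt_sum_le[OF le] by (intro exI[of _ "\<lambda>j. - u (T - t) j"]) auto
    qed
  qed
  moreover have "M-lipschitz_on {0..T} \<delta>"
  proof (rule lipschitz_onI)
    fix s t assume "s \<in> {0..T}" "t \<in> {0..T}"
    then show "dist (\<delta> s) (\<delta> t) \<le> M * dist s t"
      using lipschitz_onD[OF lip\<gamma>, of "T - s" "T - t"] by (simp add: \<delta>_def dist_real_def abs_minus_commute)
  qed (rule lipschitz_on_nonneg[OF lip\<gamma>])
  ultimately have "px q g (\<delta> T) < Suc (px q g x)"
    using px_less_along_path[OF lip H T, of M \<delta> "Suc (px q g x)"] by (simp add: \<delta>_def ends)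
  then show "px q g x = px q g x0" using 1 by (simp add: \<delta>_def ends)
qed

end
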